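(* The EED procedure is backward stable if the shifts are chosen so that $\gamma_j^{-1}\|A\|_2=O(1)$ and $\tau_j=O(1)$. Precisely: for every constant $C>0$ there is a polynomial $p_C$ in one variable, depending only on $C$ and whose degree is bounded by a fixed number independent of $C$, such that the following holds for all $n$, all real symmetric $A\in\mathbb{R}^{n\times n}$, all $j\ge1$ and all $tol>0$. Consider $j$ steps of the inexact explicit external deflation (EED) procedure for $A$: real shifts $\sigma_1,\ldots,\sigma_j$, real numbers $\widehat{\lambda}_1,\ldots,\widehat{\lambda}_{j+1}$, unit vectors $\widehat{v}_1,\ldots,\widehat{v}_{j+1}\in\mathbb{R}^n$ and residual vectors $\eta_1,\ldots,\eta_{j+1}\in\mathbb{R}^n$ with $$\Big(A+\sum_{k=1}^{i}\sigma_k\widehat{v}_k\widehat{v}_k^{\mathrm T}\Big)\widehat{v}_{i+1}=\widehat{\lambda}_{i+1}\widehat{v}_{i+1}+\eta_{i+1},\qquad i=0,1,\ldots,j,$$ and with spectral gap $\gamma_j>0$. Assume that $\|\eta_i\|_2\le tol\cdot\|A\|_2$ for $i=1,\ldots,j+1$ and that $$\tau_j\,\frac{\|A\|_2}{\gamma_j}\cdot 4\sqrt{j+1}\cdot tol<0.1 .$$ If $\gamma_j^{-1}\|A\|_2\le C$ and $\tau_j\le C$, then $$\omega_{j+1}\le p_C(j)\cdot tol\qquad\text{and}\qquad \delta_{j+1}\le p_C(j)\cdot tol\cdot\|A\|_2 .$$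
   Context: Notation: $\widehat{V}_i=[\widehat{v}_1,\ldots,\widehat{v}_i]$ and $\widehat{\Lambda}_i=\mathrm{diag}(\widehat{\lambda}_1,\ldots,\widehat{\lambda}_i)$ for $1\le i\le j+1$. $\|\cdot\|_2$ is the Euclidean norm of vectors and the spectral norm of matrices, $\|\cdot\|_{\mathrm F}$ the Frobenius norm; unit vector means Euclidean norm $1$. Loss of orthogonality: $\omega_i=\|\widehat{V}_i^{\mathrm T}\widehat{V}_i-I_i\|_{\mathrm F}$. Spectral gap: $\gamma_j=\min\{|\lambda-\theta| : \lambda\in\{\widehat{\lambda}_1,\ldots,\widehat{\lambda}_{j+1}\},\ \theta\in\{\widehat{\lambda}_1+\sigma_1,\ldots,\widehat{\lambda}_j+\sigma_j\}\}$, assumed positive. Shift-gap ratio: $\tau_j=\frac{1}{\gamma_j}\max_{1\le i\le j}|\sigma_i|$. Symmetric backward error norm: let $Q_{j+1}$ be the orthonormal factor from the polar decomposition $\widehat{V}_{j+1}=Q_{j+1}P_{j+1}$, i.e. $Q_{j+1}^{\mathrm T}Q_{j+1}=I_{j+1}$ and $P_{j+1}$ is symmetric positive semidefinite. Then $$\delta_{j+1}=\min\{\|\Delta\|_{\mathrm F} : \Delta=\Delta^{\mathrm T}\in\mathbb{R}^{n\times n},\ (A+\Delta)Q_{j+1}=Q_{j+1}\widehat{\Lambda}_{j+1}\}.$$ The procedure is called backward stable if $\omega_{j+1}=O(tol)$ and $\delta_{j+1}=O(tol\cdot\|A\|_2)$, where the constants in the big-O notation are low-degree polynomials in the number $j$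 of EED steps. *)

theory Defs
  imports "Jordan_Normal_Form.Matrix" "HOL-Computational_Algebra.Polynomial"
begin

text \<open>
  The bounding polynomial must not depend on the matrix size, so the size is a natural number
  quantified inside the formula, and the carrier-based matrices of Jordan Normal Form are used.
  Shifts, eigenvalues, vectors and residuals are functions on \<open>nat\<close>, indexed from 1 as in the text;
  their values outside the stated index ranges are never used.
\<close>

definition vec_norm2 :: "real vec \<Rightarrow> real" where
  "vec_norm2 x = sqrt (x \<bullet> x)"

definition fro_norm :: "real mat \<Rightarrow> real" where
  "fro_norm A = sqrt (\<Sum>r<dim_row A. \<Sum>c<dim_col A. (A $$ (r, c))\<^sup>2)"

definition spec_norm :: "real mat \<Rightarrow> real" where
  "spec_norm A = (SUP x\<in>{x \<in> carrier_vec (dim_col A). vec_norm2 x \<le> 1}. vec_norm2 (A *\<^sub>v x))"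

definition sym_mat :: "real mat \<Rightarrow> bool" where
  "sym_mat A \<longleftrightarrow> transpose_mat A = A"

definition psd_mat :: "nat \<Rightarrow> real mat \<Rightarrow> bool" where
  "psd_mat m P \<longleftrightarrow> P \<in> carrier_mat m m \<and> sym_mat P \<and> (\<forall>x\<in>carrier_vec m. 0 \<le> x \<bullet> (P *\<^sub>v x))"

definition V_mat :: "nat \<Rightarrow> (nat \<Rightarrow> real vec) \<Rightarrow> nat \<Rightarrow> real mat" where
  "V_mat n v i = mat_of_cols n (map v [1..<Suc i])"

definition Lambda_mat :: "(nat \<Rightarrow> real) \<Rightarrow> nat \<Rightarrow> real mat" where
  "Lambda_mat lam i = mat_diag i (\<lambda>k. lam (Suc k))"

text \<open>\<open>deflated n A \<sigma> v i\<close> is the matrix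
  \<open>A + \<sigma>\<^sub>1 v\<^sub>1 v\<^sub>1\<^sup>T + \<dots> + \<sigma>\<^sub>i v\<^sub>i v\<^sub>i\<^sup>T\<close>.\<close>

definition deflated ::
  "nat \<Rightarrow> real mat \<Rightarrow> (nat \<Rightarrow> real) \<Rightarrow> (nat \<Rightarrow> real vec) \<Rightarrow> nat \<Rightarrow> real mat" where
  "deflated n A \<sigma> v i = A + mat n n (\<lambda>(r, c). \<Sum>k=1..i. \<sigma> k * (v k $ r * v k $ c))"

definition eed_steps ::
  "nat \<Rightarrow> real mat \<Rightarrow> nat \<Rightarrow> (nat \<Rightarrow> real) \<Rightarrow> (nat \<Rightarrow> real) \<Rightarrow> (nat \<Rightarrow> real vec) \<Rightarrow> (nat \<Rightarrow> real vec) \<Rightarrow> bool" where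
  "eed_steps n A j \<sigma> lam v \<eta> \<longleftrightarrow>
     (\<forall>i\<in>{1..j+1}. v i \<in> carrier_vec n \<and> vec_norm2 (v i) = 1 \<and> \<eta> i \<in> carrier_vec n) \<and>
     (\<forall>i\<in>{0..j}. deflated n A \<sigma> v i *\<^sub>v v (i+1) = lam (i+1) \<cdot>\<^sub>v v (i+1) + \<eta> (i+1))"

definition orth_loss :: "nat \<Rightarrow> (nat \<Rightarrow> real vec) \<Rightarrow> nat \<Rightarrow> real" where
  "orth_loss n v i = fro_norm (transpose_mat (V_mat n v i) * V_mat n v i - 1\<^sub>m i)"

definition spectral_gap :: "(nat \<Rightarrow> real) \<Rightarrow> (nat \<Rightarrow> real) \<Rightarrow> nat \<Rightarrow> real" where
  "spectral_gap \<sigma> lam j =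
     Min {\<bar>l - t\<bar> | l t. l \<in> lam ` {1..j+1} \<and> t \<in> (\<lambda>k. lam k + \<sigma> k) ` {1..j}}"

definition shift_gap_ratio :: "(nat \<Rightarrow> real) \<Rightarrow> (nat \<Rightarrow> real) \<Rightarrow> nat \<Rightarrow> real" where
  "shift_gap_ratio \<sigma> lam j = 1 / spectral_gap \<sigma> lam j * Max ((\<lambda>i. \<bar>\<sigma> i\<bar>) ` {1..j})"

text \<open>Such a \<open>Q\<close> exists and is unique precisely when \<open>V\<close> has full column rank.\<close>

definition polar_factor :: "real mat \<Rightarrow> real mat" where
  "polar_factor V = (THE Q. Q \<in> carrier_mat (dim_row V) (dim_col V) \<and>
     transpose_mat Q * Q = 1\<^sub>m (dim_col V) \<and> (\<exists>P. psd_mat (dim_col V) P \<and> V = Q * P))"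

text \<open>\<open>Least\<close> on the reals denotes an attained minimum.\<close>

definition sym_backward_error ::
  "nat \<Rightarrow> real mat \<Rightarrow> (nat \<Rightarrow> real) \<Rightarrow> (nat \<Rightarrow> real vec) \<Rightarrow> nat \<Rightarrow> real" where
  "sym_backward_error n A lam v i =
     (let Q = polar_factor (V_mat n v i) in
      LEAST x. x \<in> {fro_norm D | D. D \<in> carrier_mat n n \<and> sym_mat D \<and>
                                     (A + D) * Q = Q * Lambda_mat lam i})"

end

theory Submission
  imports Defs "HOL-Analysis.L2_Norm" "Jordan_Normal_Form.Determinant"
begin

text \<open>
  Collecting the steps gives \<open>A V + V T = V \<Lambda> + E\<close>, where \<open>T\<close> is the strictly upper part of the
  Gram matrix \<open>G = V\<^sup>T V\<close> with its rows scaled by the shifts. Since \<open>V\<^sup>T A V\<close> is symmetric, this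
  determines the commutator \<open>[G, \<Lambda>]\<close>; entrywise it expresses each off-diagonal entry of \<open>G\<close>,
  multiplied by a number of modulus at least \<open>\<gamma>\<close>, through products of off-diagonal entries and the
  residuals. As \<open>\<gamma> \<le> \<bar>\<sigma>\<^sub>1\<bar>\<close> forces \<open>\<tau> \<ge> 1\<close>, the smallness assumption closes an induction
  over the number of columns and bounds the loss of orthogonality.
  Then \<open>G\<close> is close to the identity and \<open>P = G\<^bsup>1/2\<^esup>\<close> exists with \<open>V = Q P\<close>. The
  commutator \<open>[P, \<Lambda>]\<close> is controlled by \<open>[G, \<Lambda>]\<close>, hence so is the residual \<open>R = A Q - Q \<Lambda>\<close>, and the
  optimal symmetric backward error is at most a multiple of the norm of \<open>R\<close>.
\<close>

section \<open>The Frobenius norm\<close>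

lemma index_mult_mat_sum:
  fixes A B :: "real mat"
  assumes "dim_col A = dim_row B" "i < dim_row A" "k < dim_col B"
  shows "(A * B) $$ (i, k) = (\<Sum>l<dim_col A. A $$ (i, l) * B $$ (l, k))"
  using assms by (simp add: scalar_prod_def atLeast0LessThan)

text \<open>The premises speak of \<open>dim_row\<close> and \<open>dim_col\<close> instead of
  carriers, so rewriting can discharge them without guessing intermediate sizes. The same form is
  kept for all rules collected in \<open>mat_ring\<close>, which expand to sums of right-nested
  products with transposes pushed inwards.\<close>

lemma mult_assoc_dims:
  fixes A B C :: "real mat"
  assumes "dim_col A = dim_row B" "dim_col B = dim_row C"
  shows "A * B * C = A * (B * C)"
  by (rule assoc_mult_mat[of _ "dim_row A" "dim_row B" _ "dim_row C" _ "dim_col C"])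
    (use assms in auto)

lemma mult_distrib_dims:
  fixes A B C :: "real mat"
  shows "dim_col A = dim_row B \<Longrightarrow> dim_row B = dim_row C \<Longrightarrow> dim_col B = dim_col C \<Longrightarrow>
      A * (B + C) = A * B + A * C"
    and "dim_col A = dim_row C \<Longrightarrow> dim_row A = dim_row B \<Longrightarrow> dim_col A = dim_col B \<Longrightarrow>
      (A + B) * C = A * C + B * C"
    and "dim_col A = dim_row B \<Longrightarrow> dim_row B = dim_row C \<Longrightarrow> dim_col B = dim_col C \<Longrightarrow>
      A * (B - C) = A * B - A * C"
    and "dim_col A = dim_row C \<Longrightarrow> dim_row A = dim_row B \<Longrightarrow> dim_col A = dim_col B \<Longrightarrow>
      (A - B) * C = A * C - B * C"
    and "dim_col A = dim_row B \<Longrightarrow> A * (a \<cdot>\<^sub>m B) = a \<cdot>\<^sub>m (A * B)"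
    and "dim_col A = dim_row B \<Longrightarrow> (a \<cdot>\<^sub>m A) * B = a \<cdot>\<^sub>m (A * B)"
  by (rule eq_matI;
      simp add: index_mult_mat_sum algebra_simps sum.distrib sum_subtractf sum_distrib_left
        del: index_mult_mat(1))+

lemma transpose_dims:
  fixes A B :: "real mat"
  shows "dim_col A = dim_row B \<Longrightarrow> transpose_mat (A * B) = transpose_mat B * transpose_mat A"
    and "dim_row A = dim_row B \<Longrightarrow> dim_col A = dim_col B \<Longrightarrow>
      transpose_mat (A + B) = transpose_mat A + transpose_mat B"
    and "dim_row A = dim_row B \<Longrightarrow> dim_col A = dim_col B \<Longrightarrow>
      transpose_mat (A - B) = transpose_mat A - transpose_mat B"
    and "transpose_mat (a \<cdot>\<^sub>m A) = a \<cdot>\<^sub>m transpose_mat A"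
  by (rule eq_matI; simp add: index_mult_mat_sum mult.commute del: index_mult_mat(1))+

lemma one_mult_dims:
  fixes A :: "real mat"
  shows "dim_row A = m \<Longrightarrow> 1\<^sub>m m * A = A" "dim_col A = m \<Longrightarrow> A * 1\<^sub>m m = A"
  by auto

lemmas mat_ring = mult_assoc_dims mult_distrib_dims transpose_dims one_mult_dims

section \<open>Frobenius inner product and norm inequalities\<close>

text \<open>This is the trace of \<open>transpose_mat A * B\<close> for matrices of equal
  dimensions. Both index ranges come from \<open>A\<close>, so symmetry carries dimension
  premises.\<close>

definition fro_inner :: "real mat \<Rightarrow> real mat \<Rightarrow> real" where
  "fro_inner A B = (\<Sum>r<dim_row A. \<Sum>c<dim_col A. A $$ (r, c) * B $$ (r, c))"

text \<open>Viewing the matrix as a function on index pairs gives access to the triangle and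
  Cauchy-Schwarz inequalities for \<open>L2_set\<close>.\<close>

lemma fro_norm_L2:
  "fro_norm A = L2_set (\<lambda>p. A $$ p) ({..<dim_row A} \<times> {..<dim_col A})"
  by (simp add: fro_norm_def L2_set_def sum.cartesian_product)

lemma fro_norm_nonneg: "0 \<le> fro_norm A"
  by (simp add: fro_norm_L2 L2_set_nonneg)

lemma fro_norm_square: "(fro_norm A)\<^sup>2 = fro_inner A A"
  by (simp add: fro_norm_def fro_inner_def sum_nonneg power2_eq_square)

lemma fro_norm_eq_0: "fro_norm A = 0 \<longleftrightarrow> A = 0\<^sub>m (dim_row A) (dim_col A)"
  by (auto simp: fro_norm_L2 L2_set_eq_0_iff intro!: eq_matI) (metis index_zero_mat(1))

lemma fro_inner_linear:
  assumes "dim_row A = dim_row B" "dim_col A = dim_col B"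
  shows "fro_inner (A + B) C = fro_inner A C + fro_inner B C"
    and "fro_inner (A - B) C = fro_inner A C - fro_inner B C"
  using assms by (simp_all add: fro_inner_def algebra_simps sum.distrib sum_subtractf)

lemma fro_inner_commute:
  assumes "dim_row A = dim_row B" "dim_col A = dim_col B"
  shows "fro_inner A B = fro_inner B A"
  using assms by (simp add: fro_inner_def mult.commute)

lemma fro_inner_transpose:
  assumes "dim_row A = dim_row B" "dim_col A = dim_col B"
  shows "fro_inner (transpose_mat A) (transpose_mat B) = fro_inner A B"
  using assms by (simp add: fro_inner_def sum.swap[of _ "{..<dim_row B}"])

lemma fro_inner_add_right:
  assumes "dim_row A = dim_row B" "dim_col A = dim_col B" "dim_row A = dim_row C" "dim_col A = dim_col C"
  shows "fro_inner A (B + C) = fro_inner A B + fro_inner A C"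
  using assms by (simp add: fro_inner_def algebra_simps sum.distrib)

text \<open>Left multiplication by \<open>A\<close> has left multiplication by its transpose as
  adjoint; both sides are the same triple sum in a different order.\<close>

lemma fro_inner_mult_left:
  assumes "dim_col A = dim_row B" "dim_row C = dim_row A" "dim_col C = dim_col B"
  shows "fro_inner (A * B) C = fro_inner B (transpose_mat A * C)"
proof -
  have "fro_inner (A * B) C =
      (\<Sum>r<dim_row A. \<Sum>c<dim_col B. \<Sum>k<dim_row B. B $$ (k, c) * (A $$ (r, k) * C $$ (r, c)))"
    using assms by (simp add: fro_inner_def index_mult_mat_sum sum_distrib_right sum_distrib_left ac_simps
        del: index_mult_mat(1))
  also have "\<dots> = (\<Sum>c<dim_col B. \<Sum>k<dim_row B. \<Sum>r<dim_row A. B $$ (k, c) * (A $$ (r, k) * C $$ (r, c)))"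
    by (subst sum.swap, rule sum.cong[OF refl], rule sum.swap)
  also have "\<dots> = (\<Sum>k<dim_row B. \<Sum>c<dim_col B. \<Sum>r<dim_row A. B $$ (k, c) * (A $$ (r, k) * C $$ (r, c)))"
    by (rule sum.swap)
  also have "\<dots> = fro_inner B (transpose_mat A * C)"
    using assms by (simp add: fro_inner_def index_mult_mat_sum sum_distrib_left
        del: index_mult_mat(1))
  finally show ?thesis .
qed

lemma fro_inner_mult_right:
  assumes "dim_col A = dim_row B" "dim_row C = dim_row A" "dim_col C = dim_col B"
  shows "fro_inner (A * B) C = fro_inner A (C * transpose_mat B)"
proof -
  have "fro_inner (A * B) C = fro_inner (transpose_mat B * transpose_mat A) (transpose_mat C)"
    using assms fro_inner_transpose[of "A * B" C] by (simp add: transpose_dims)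
  also have "\<dots> = fro_inner (transpose_mat A) (B * transpose_mat C)"
    using assms by (subst fro_inner_mult_left) auto
  also have "\<dots> = fro_inner A (C * transpose_mat B)"
    using assms fro_inner_transpose[of A "C * transpose_mat B"] by (simp add: transpose_dims)
  finally show ?thesis .
qed

lemma fro_inner_le:
  assumes "dim_row A = dim_row B" "dim_col A = dim_col B"
  shows "\<bar>fro_inner A B\<bar> \<le> fro_norm A * fro_norm B"
proof -
  have "\<bar>fro_inner A B\<bar> \<le> (\<Sum>p\<in>{..<dim_row A} \<times> {..<dim_col A}. \<bar>A $$ p\<bar> * \<bar>B $$ p\<bar>)"
    unfolding fro_inner_def sum.cartesian_product
    by (rule order_trans[OF sum_abs]) (auto simp: abs_mult intro!: sum_mono)
  also have "\<dots> \<le> fro_norm A * fro_norm B"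
    unfolding fro_norm_L2 assms by (rule L2_set_mult_ineq)
  finally show ?thesis .
qed

lemma fro_norm_add_le:
  assumes "dim_row A = dim_row B" "dim_col A = dim_col B"
  shows "fro_norm (A + B) \<le> fro_norm A + fro_norm B"
proof -
  have "fro_norm (A + B) = L2_set (\<lambda>p. A $$ p + B $$ p) ({..<dim_row A} \<times> {..<dim_col A})"
    unfolding fro_norm_L2 using assms by (intro L2_set_cong) auto
  also have "\<dots> \<le> fro_norm A + fro_norm B"
    unfolding fro_norm_L2 assms by (rule L2_set_triangle_ineq)
  finally show ?thesis .
qed

lemma fro_norm_smult: "fro_norm (a \<cdot>\<^sub>m A) = \<bar>a\<bar> * fro_norm A"
  by (simp add: fro_norm_def power_mult_distrib real_sqrt_mult flip: sum_distrib_left)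

lemma fro_norm_minus_le:
  assumes "dim_row A = dim_row B" "dim_col A = dim_col B"
  shows "fro_norm (A - B) \<le> fro_norm A + fro_norm B"
proof -
  have "A - B = A + (- 1) \<cdot>\<^sub>m B"
    using assms by (intro eq_matI) auto
  then show ?thesis
    using fro_norm_add_le[of A "(- 1) \<cdot>\<^sub>m B"] assms by (simp add: fro_norm_smult)
qed

lemma fro_norm_transpose: "fro_norm (transpose_mat A) = fro_norm A"
  by (simp add: fro_norm_def sum.swap[of _ "{..<dim_row A}"])

lemma abs_index_le_fro_norm:
  assumes "i < dim_row A" "k < dim_col A"
  shows "\<bar>A $$ (i, k)\<bar> \<le> fro_norm A"
proof -
  have "\<bar>A $$ (i, k)\<bar> \<le> L2_set (\<lambda>p. \<bar>A $$ p\<bar>) ({..<dim_row A} \<times> {..<dim_col A})"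
    using assms by (intro member_le_L2_set) auto
  then show ?thesis
    by (simp add: fro_norm_L2 L2_set_def)
qed

text \<open>Cauchy-Schwarz bounds each entry by a row factor times a column factor, and the double
  sum of such products factorizes. Arbitrary index sets are allowed because rectangular blocks of
  one array are needed later.\<close>

lemma L2_set_matrix_mult:
  fixes f g :: "nat \<Rightarrow> nat \<Rightarrow> real"
  shows "L2_set (\<lambda>(k, l). \<Sum>m\<in>M. f k m * g m l) (I \<times> J)
    \<le> L2_set (\<lambda>(k, l). f k l) (I \<times> M) * L2_set (\<lambda>(k, l). g k l) (M \<times> J)"
proof -
  have entry: "(\<Sum>m\<in>M. f k m * g m l)\<^sup>2 \<le> (\<Sum>m\<in>M. (f k m)\<^sup>2) * (\<Sum>m\<in>M. (g m l)\<^sup>2)" for k l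
  proof -
    have "\<bar>\<Sum>m\<in>M. f k m * g m l\<bar> \<le> (\<Sum>m\<in>M. \<bar>f k m\<bar> * \<bar>g m l\<bar>)"
      by (rule order_trans[OF sum_abs]) (simp add: abs_mult)
    also have "\<dots> \<le> L2_set (f k) M * L2_set (\<lambda>m. g m l) M"
      by (rule L2_set_mult_ineq)
    finally have "\<bar>\<Sum>m\<in>M. f k m * g m l\<bar>\<^sup>2 \<le> (L2_set (f k) M * L2_set (\<lambda>m. g m l) M)\<^sup>2"
      by (rule power_mono) simp
    then show ?thesis
      by (simp add: L2_set_def power_mult_distrib sum_nonneg)
  qed
  have "(\<Sum>k\<in>I. \<Sum>l\<in>J. (\<Sum>m\<in>M. f k m * g m l)\<^sup>2)
      \<le> (\<Sum>k\<in>I. \<Sum>l\<in>J. (\<Sum>m\<in>M. (f k m)\<^sup>2) * (\<Sum>m\<in>M. (g m l)\<^sup>2))"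
    by (intro sum_mono entry)
  also have "\<dots> = (\<Sum>k\<in>I. \<Sum>m\<in>M. (f k m)\<^sup>2) * (\<Sum>l\<in>J. \<Sum>m\<in>M. (g m l)\<^sup>2)"
    by (rule sum_product[symmetric])
  also have "(\<Sum>l\<in>J. \<Sum>m\<in>M. (g m l)\<^sup>2) = (\<Sum>m\<in>M. \<Sum>l\<in>J. (g m l)\<^sup>2)"
    by (rule sum.swap)
  finally show ?thesis
    by (simp add: L2_set_def case_prod_unfold sum.cartesian_product' real_sqrt_mult[symmetric])
qed

lemma fro_norm_mult_le:
  assumes "dim_col A = dim_row B"
  shows "fro_norm (A * B) \<le> fro_norm A * fro_norm B"
proof -
  have "fro_norm (A * B) = L2_set (\<lambda>(k, l). \<Sum>m<dim_row B. A $$ (k, m) * B $$ (m, l))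
      ({..<dim_row A} \<times> {..<dim_col B})"
    unfolding fro_norm_L2 using assms
    by (intro L2_set_cong) (auto simp: index_mult_mat_sum simp del: index_mult_mat(1))
  also have "\<dots> \<le> fro_norm A * fro_norm B"
    using L2_set_matrix_mult[of "\<lambda>k m. A $$ (k, m)" "\<lambda>m l. B $$ (m, l)"] assms
    by (simp add: fro_norm_L2)
  finally show ?thesis .
qed

text \<open>In effect the squared spectral norm of \<open>V\<close> is at most 1 plus its loss of
  orthogonality. Bounding \<open>V\<close> by its Frobenius norm would cost a factor growing with
  the number of columns, which the smallness assumption could not absorb. With
  \<open>S = transpose_mat V * E\<close>, the argument combines
  \<open>(fro_norm S)\<^sup>2 = fro_inner E (V * S)\<close> with a bound on \<open>V * S\<close> and
  cancels \<open>(fro_norm S)\<^sup>2\<close>.\<close>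

lemma fro_norm_transpose_mult_le:
  assumes "dim_row V = dim_row E"
  shows "(fro_norm (transpose_mat V * E))\<^sup>2
    \<le> (1 + fro_norm (transpose_mat V * V - 1\<^sub>m (dim_col V))) * (fro_norm E)\<^sup>2"
proof -
  define S where "S = transpose_mat V * E"
  define w where "w = fro_norm (transpose_mat V * V - 1\<^sub>m (dim_col V))"
  have dS: "dim_row S = dim_col V" "dim_col S = dim_col E"
    by (simp_all add: S_def)
  have eq: "transpose_mat V * V * S = S + (transpose_mat V * V - 1\<^sub>m (dim_col V)) * S"
    using dS by (simp add: mult_distrib_dims one_mult_dims)
      (rule eq_matI; simp del: index_mult_mat(1))
  have "(fro_norm (V * S))\<^sup>2 = fro_inner S (transpose_mat V * V * S)"
    using dS by (simp add: fro_norm_square fro_inner_mult_left mult_assoc_dims)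
  also have "\<dots> = (fro_norm S)\<^sup>2 + fro_inner S ((transpose_mat V * V - 1\<^sub>m (dim_col V)) * S)"
    unfolding eq using dS by (subst fro_inner_add_right) (auto simp: fro_norm_square)
  also have "\<dots> \<le> (fro_norm S)\<^sup>2 + fro_norm S * (w * fro_norm S)"
  proof -
    have "fro_inner S ((transpose_mat V * V - 1\<^sub>m (dim_col V)) * S)
        \<le> fro_norm S * fro_norm ((transpose_mat V * V - 1\<^sub>m (dim_col V)) * S)"
      using fro_inner_le[of S "(transpose_mat V * V - 1\<^sub>m (dim_col V)) * S"] dS by simp
    also have "\<dots> \<le> fro_norm S * (w * fro_norm S)"
      unfolding w_def using dS by (intro mult_left_mono fro_norm_mult_le fro_norm_nonneg) auto
    finally show ?thesis by simp
  qed
  finally have VS: "(fro_norm (V * S))\<^sup>2 \<le> (1 + w) * (fro_norm S)\<^sup>2"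
    by (simp add: algebra_simps power2_eq_square)
  have "(fro_norm S)\<^sup>2 = fro_inner E (V * S)"
    unfolding fro_norm_square using dS assms
    by (subst S_def) (simp add: fro_inner_mult_left)
  also have "\<dots> \<le> fro_norm E * fro_norm (V * S)"
    using fro_inner_le[of E "V * S"] dS assms by simp
  finally have "((fro_norm S)\<^sup>2)\<^sup>2 \<le> (fro_norm E * fro_norm (V * S))\<^sup>2"
    by (rule power_mono) simp
  also have "\<dots> \<le> (fro_norm E)\<^sup>2 * ((1 + w) * (fro_norm S)\<^sup>2)"
    unfolding power_mult_distrib by (intro mult_left_mono VS) simp
  finally have le: "(fro_norm S)\<^sup>2 * (fro_norm S)\<^sup>2 \<le> ((1 + w) * (fro_norm E)\<^sup>2) * (fro_norm S)\<^sup>2"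
    by (simp add: power2_eq_square ac_simps)
  show ?thesis
  proof (cases "fro_norm S = 0")
    case True
    have "0 \<le> w" by (simp add: w_def fro_norm_nonneg)
    then show ?thesis using True by (simp add: S_def[symmetric] w_def[symmetric])
  next
    case False
    then have "0 < (fro_norm S)\<^sup>2" by simp
    then show ?thesis
      using mult_right_le_imp_le[OF le] by (simp add: S_def w_def)
  qed
qed

section \<open>Square roots and polar factors near the identity\<close>

lemma fro_norm_zero: "fro_norm (0\<^sub>m m k) = 0"
  by (simp add: fro_norm_eq_0)

lemma fro_norm_tendsto_bound:
  assumes Y: "\<And>k. Y k \<in> carrier_mat m m" "\<And>k. fro_norm (Y k) \<le> b" and L: "L \<in> carrier_mat m m"
    and lim: "\<And>i l. i < m \<Longrightarrow> l < m \<Longrightarrow> (\<lambda>k. Y k $$ (i, l)) \<longlonglongrightarrow> L $$ (i, l)"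
  shows "fro_norm L \<le> b"
proof -
  have dY: "dim_row (Y k) = m" "dim_col (Y k) = m" for k
    using Y(1)[of k] by auto
  have "(\<lambda>k. fro_norm (Y k)) \<longlonglongrightarrow> fro_norm L"
    unfolding fro_norm_def dY using L
    by (auto intro!: tendsto_intros lim)
  then show ?thesis
    by (rule LIMSEQ_le_const2) (use Y(2) in auto)
qed

text \<open>\<open>I + Y\<close> is a square root of \<open>I + X\<close> iff \<open>Y = (X - Y\<^sup>2)/2\<close>; the right-hand side contracts
  the ball of radius 1/2.\<close>

lemma mat_sqrt_exists:
  assumes X: "X \<in> carrier_mat m m" "transpose_mat X = X" "fro_norm X \<le> 3/4"
  obtains Y where "Y \<in> carrier_mat m m" "transpose_mat Y = Y" "fro_norm Y \<le> 1/2" "Y + Y + Y * Y = X"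
proof -
  \<comment> \<open>Fixed-point iteration started at zero; symmetry passes from each iterate to the
    next.\<close>
  define Y where "Y = rec_nat (0\<^sub>m m m) (\<lambda>_ Z. (1/2) \<cdot>\<^sub>m (X - Z * Z))"
  have Y0: "Y 0 = 0\<^sub>m m m" and YS: "Y (Suc k) = (1/2) \<cdot>\<^sub>m (X - Y k * Y k)" for k
    by (simp_all add: Y_def)
  have Yc: "Y k \<in> carrier_mat m m" for k
    by (induction k) (use X in \<open>auto simp: Y0 YS\<close>)
  have dX: "dim_row X = m" "dim_col X = m" and dY: "dim_row (Y k) = m" "dim_col (Y k) = m" for k
    using X Yc[of k] by auto
  have Ysym: "transpose_mat (Y k) = Y k" for k
    by (induction k) (simp_all add: Y0 YS transpose_dims dX dY X zero_transpose_mat)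
  have Yle: "fro_norm (Y k) \<le> 1/2" for k
  proof (induction k)
    case (Suc k)
    have "fro_norm (X - Y k * Y k) \<le> fro_norm X + fro_norm (Y k) * fro_norm (Y k)"
      using fro_norm_minus_le[of X "Y k * Y k"] fro_norm_mult_le[of "Y k" "Y k"] by (simp add: dX dY)
    \<comment> \<open>The threshold 3/4 on \<open>X\<close> is exactly what keeps the ball of radius
      1/2 invariant: half of 3/4 + 1/4 is 1/2.\<close>
    also have "\<dots> \<le> 3/4 + 1/2 * (1/2)"
      using Suc X(3) by (intro add_mono mult_mono) (auto simp: fro_norm_nonneg)
    finally show ?case by (simp add: YS fro_norm_smult)
  qed (simp add: Y0 fro_norm_zero)
  have step: "fro_norm (Y (Suc (Suc k)) - Y (Suc k)) \<le> 1/2 * fro_norm (Y (Suc k) - Y k)" for k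
  proof -
    let ?D = "Y (Suc k) - Y k"
    \<comment> \<open>Difference of squares without commutativity. Both outer factors have norm at
      most 1/2, and the iteration halves the sum, which gives the contraction factor 1/2.\<close>
    have sq: "Y (Suc k) * ?D + ?D * Y k = Y (Suc k) * Y (Suc k) - Y k * Y k"
      by (rule eq_matI; simp add: mult_distrib_dims dY del: index_mult_mat(1))
    have entry: "Y (Suc r) $$ (i, l) = 1/2 * (X $$ (i, l) - (Y r * Y r) $$ (i, l))"
      if "i < m" "l < m" for r i l
      using that by (simp add: YS dX dY del: index_mult_mat(1))
    have "Y (Suc (Suc k)) - Y (Suc k) = (-(1/2)) \<cdot>\<^sub>m (Y (Suc k) * ?D + ?D * Y k)"
      unfolding sq using entry[of _ _ "Suc k"] entry[of _ _ k]
      by (intro eq_matI) (simp_all add: dY field_simps del: index_mult_mat(1))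
    then have "fro_norm (Y (Suc (Suc k)) - Y (Suc k)) = 1/2 * fro_norm (Y (Suc k) * ?D + ?D * Y k)"
      by (simp add: fro_norm_smult)
    also have "fro_norm (Y (Suc k) * ?D + ?D * Y k) \<le>
        fro_norm (Y (Suc k)) * fro_norm ?D + fro_norm ?D * fro_norm (Y k)"
      by (rule order_trans[OF fro_norm_add_le add_mono[OF fro_norm_mult_le fro_norm_mult_le]])
        (simp_all add: dY)
    also have "\<dots> \<le> 1/2 * fro_norm ?D + fro_norm ?D * (1/2)"
      by (intro add_mono mult_mono Yle order_refl fro_norm_nonneg) auto
    finally show ?thesis by simp
  qed
  have geom: "fro_norm (Y (Suc k) - Y k) \<le> (1/2) ^ k" for k
  proof (induction k)
    case 0
    have "Y (Suc 0) - Y 0 = Y (Suc 0)" by (rule eq_matI) (auto simp: Y0 dY)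
    then show ?case using Yle[of "Suc 0"] by simp
  next
    case (Suc k)
    then show ?case using step[of k] by simp
  qed
  \<comment> \<open>Convergence is shown entry by entry: the increments are dominated by a geometric
    series, and their partial sums telescope.\<close>
  have conv: "convergent (\<lambda>k. Y k $$ (i, l))" if "i < m" "l < m" for i l
  proof -
    have "norm (Y (Suc k) $$ (i, l) - Y k $$ (i, l)) \<le> (1/2) ^ k" for k
      using abs_index_le_fro_norm[of i "Y (Suc k) - Y k" l] geom[of k] that by (simp add: dY)
    then have "summable (\<lambda>k. Y (Suc k) $$ (i, l) - Y k $$ (i, l))"
      by (intro summable_comparison_test'[OF summable_geometric[of "1/2::real"]]) auto
    then have "convergent (\<lambda>k. \<Sum>r<k. Y (Suc r) $$ (i, l) - Y r $$ (i, l))"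
      by (simp add: summable_iff_convergent)
    then have "convergent (\<lambda>k. Y k $$ (i, l) - Y 0 $$ (i, l))"
      by (simp add: sum_lessThan_telescope[of "\<lambda>r. Y r $$ (i, l)"])
    then show ?thesis
      by (simp add: convergent_diff_const_right_iff)
  qed
  define L where "L = mat m m (\<lambda>(i, l). lim (\<lambda>k. Y k $$ (i, l)))"
  have Lc: "L \<in> carrier_mat m m" by (simp add: L_def)
  have dL: "dim_row L = m" "dim_col L = m" by (simp_all add: L_def)
  have lim: "(\<lambda>k. Y k $$ (i, l)) \<longlonglongrightarrow> L $$ (i, l)" if "i < m" "l < m" for i l
    using conv[OF that] that by (simp add: L_def convergent_LIMSEQ_iff)
  have "transpose_mat L = L"
  proof (rule eq_matI)
    fix i l assume "i < dim_row L" "l < dim_col L"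
    then have il: "i < m" "l < m" by (simp_all add: dL)
    have "Y k $$ (i, l) = Y k $$ (l, i)" for k
      using Ysym[of k] il by (metis dY index_transpose_mat(1))
    then show "transpose_mat L $$ (i, l) = L $$ (i, l)"
      using il by (simp add: L_def)
  qed (simp_all add: dL)
  moreover have "fro_norm L \<le> 1/2"
    by (rule fro_norm_tendsto_bound[OF Yc Yle Lc lim])
  moreover have "L + L + L * L = X"
  proof (rule eq_matI)
    fix i l assume "i < dim_row X" "l < dim_col X"
    then have il: "i < m" "l < m" by (simp_all add: dX)
    have eq: "Y (Suc k) $$ (i, l) = 1/2 * (X $$ (i, l) - (\<Sum>r<m. Y k $$ (i, r) * Y k $$ (r, l)))" for k
      using il by (simp add: YS index_mult_mat_sum dX dY del: index_mult_mat(1))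
    have "(\<lambda>k. Y (Suc k) $$ (i, l)) \<longlonglongrightarrow> 1/2 * (X $$ (i, l) - (\<Sum>r<m. L $$ (i, r) * L $$ (r, l)))"
      unfolding eq using il by (auto intro!: tendsto_intros lim)
    moreover have "(\<lambda>k. Y (Suc k) $$ (i, l)) \<longlonglongrightarrow> L $$ (i, l)"
      using lim[OF il] by (rule LIMSEQ_Suc)
    ultimately have "L $$ (i, l) = 1/2 * (X $$ (i, l) - (\<Sum>r<m. L $$ (i, r) * L $$ (r, l)))"
      by (rule LIMSEQ_unique[rotated])
    then show "(L + L + L * L) $$ (i, l) = X $$ (i, l)"
      using il by (simp add: index_mult_mat_sum dL del: index_mult_mat(1))
  qed (simp_all add: dL dX)
  ultimately show ?thesis using that Lc by blast
qed

section \<open>Coercivity near the identity and the polar factor\<close>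

lemma fro_inner_cols:
  assumes "dim_row A = dim_row B" "dim_col A = dim_col B"
  shows "fro_inner A B = (\<Sum>c<dim_col A. col A c \<bullet> col B c)"
  using assms by (simp add: fro_inner_def scalar_prod_def atLeast0LessThan sum.swap[of _ "{..<dim_row B}"])

lemma col_mult_dims:
  fixes A B :: "real mat"
  assumes "dim_col A = dim_row B" "k < dim_col B"
  shows "col (A * B) k = A *\<^sub>v col B k"
  using assms by (intro eq_vecI) auto

text \<open>The inner product splits into the quadratic form of \<open>P\<close> evaluated at each
  column of \<open>D\<close>.\<close>

lemma psd_fro_inner_nonneg:
  assumes "psd_mat m P" "dim_row D = m"
  shows "0 \<le> fro_inner D (P * D)"
  using assms by (auto simp: psd_mat_def fro_inner_cols col_mult_dims simp del: col_mult2 intro!: sum_nonneg)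

text \<open>The perturbation \<open>Y\<close> changes the squared norm of \<open>D\<close> by at
  most half of it. This coercivity yields invertibility of \<open>1\<^sub>m m + Y\<close> and
  uniqueness of the polar factor.\<close>

lemma fro_inner_id_plus_ge:
  assumes "Y \<in> carrier_mat m m" "fro_norm Y \<le> 1/2" "dim_row D = m"
  shows "(fro_norm D)\<^sup>2 / 2 \<le> fro_inner D ((1\<^sub>m m + Y) * D)"
proof -
  have d: "dim_row Y = m" "dim_col Y = m" using assms by auto
  have "\<bar>fro_inner D (Y * D)\<bar> \<le> fro_norm D * fro_norm (Y * D)"
    using assms d by (intro fro_inner_le) auto
  also have "\<dots> \<le> fro_norm D * (fro_norm Y * fro_norm D)"
    using assms d by (intro mult_left_mono fro_norm_mult_le fro_norm_nonneg) auto
  also have "\<dots> \<le> fro_norm D * (1/2 * fro_norm D)"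
    by (intro mult_left_mono mult_right_mono assms fro_norm_nonneg)
  finally have "- ((fro_norm D)\<^sup>2 / 2) \<le> fro_inner D (Y * D)"
    by (simp add: power2_eq_square)
  moreover have "fro_inner D ((1\<^sub>m m + Y) * D) = (fro_norm D)\<^sup>2 + fro_inner D (Y * D)"
    using assms d by (simp add: mult_distrib_dims one_mult_dims fro_inner_add_right fro_norm_square)
  ultimately show ?thesis by simp
qed

lemma quadratic_id_plus_ge:
  assumes "Y \<in> carrier_mat m m" "fro_norm Y \<le> 1/2" "x \<in> carrier_vec m"
  shows "(x \<bullet> x) / 2 \<le> x \<bullet> ((1\<^sub>m m + Y) *\<^sub>v x)"
proof -
  \<comment> \<open>The vector is treated as a matrix with one column, so that the matrix estimate
    applies.\<close>
  define Z where "Z = mat_of_cols m [x]"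
  have Z: "dim_row Z = m" "dim_col Z = 1" "col Z 0 = x"
    using assms by (auto simp: Z_def)
  have "fro_inner Z Z = x \<bullet> x" "fro_inner Z ((1\<^sub>m m + Y) * Z) = x \<bullet> ((1\<^sub>m m + Y) *\<^sub>v x)"
    using Z assms(1) by (subst fro_inner_cols; simp add: col_mult_dims)+
  then show ?thesis
    using fro_inner_id_plus_ge[OF assms(1,2) Z(1)] by (simp add: fro_norm_square)
qed

lemma scalar_prod_self_nonneg: "0 \<le> x \<bullet> (x :: real vec)"
  by (simp add: scalar_prod_def sum_nonneg)

lemma psd_id_plus:
  assumes "Y \<in> carrier_mat m m" "fro_norm Y \<le> 1/2" "transpose_mat Y = Y"
  shows "psd_mat m (1\<^sub>m m + Y)"
  unfolding psd_mat_def sym_mat_def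
proof (intro conjI ballI)
  show "1\<^sub>m m + Y \<in> carrier_mat m m" using assms by simp
  show "transpose_mat (1\<^sub>m m + Y) = 1\<^sub>m m + Y"
    using assms by (auto simp: transpose_dims)
  fix x :: "real vec" assume "x \<in> carrier_vec m"
  then show "0 \<le> x \<bullet> ((1\<^sub>m m + Y) *\<^sub>v x)"
    using quadratic_id_plus_ge[OF assms(1,2)] scalar_prod_self_nonneg[of x] by fastforce
qed

text \<open>Coercivity excludes a nonzero kernel vector, so the determinant does not vanish and the
  matrix is a unit of the matrix ring.\<close>

lemma id_plus_inverse:
  assumes Y: "Y \<in> carrier_mat m m" "fro_norm Y \<le> 1/2"
  obtains B where "B \<in> carrier_mat m m" "(1\<^sub>m m + Y) * B = 1\<^sub>m m" "B * (1\<^sub>m m + Y) = 1\<^sub>m m"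
proof -
  have "det (1\<^sub>m m + Y) \<noteq> 0"
  proof
    assume "det (1\<^sub>m m + Y) = 0"
    then obtain x where x: "x \<in> carrier_vec m" "x \<noteq> 0\<^sub>v m" "(1\<^sub>m m + Y) *\<^sub>v x = 0\<^sub>v m"
      using det_0_iff_vec_prod_zero_field[of "1\<^sub>m m + Y" m] Y by auto
    then have "x \<bullet> x = 0"
      using quadratic_id_plus_ge[OF Y x(1)] scalar_prod_self_nonneg[of x] by simp
    then have "x = 0\<^sub>v m"
      using x(1) by (auto simp: scalar_prod_def sum_nonneg_eq_0_iff intro!: eq_vecI)
    with x show False by simp
  qed
  then have "1\<^sub>m m + Y \<in> Units (ring_mat TYPE(real) m undefined)"
    using Y by (intro det_non_zero_imp_unit) auto
  then show ?thesis
    using that by (auto simp: Units_def ring_mat_def)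
qed

text \<open>Existence: if \<open>P = 1\<^sub>m m + Y\<close> is the square root of the Gram matrix,
  then \<open>V\<close> times the inverse of \<open>P\<close> has orthonormal columns. Since
  \<open>polar_factor\<close> is a definite description, uniqueness among all positive semidefinite
  factorizations must be shown as well.\<close>

lemma polar_factor_near_orthonormal:
  assumes V: "V \<in> carrier_mat n m" and near: "fro_norm (transpose_mat V * V - 1\<^sub>m m) \<le> 3/4"
  obtains Y where "polar_factor V \<in> carrier_mat n m"
    "transpose_mat (polar_factor V) * polar_factor V = 1\<^sub>m m"
    "Y \<in> carrier_mat m m" "transpose_mat Y = Y" "fro_norm Y \<le> 1/2"
    "V = polar_factor V * (1\<^sub>m m + Y)"
proof -
  have dV: "dim_row V = n" "dim_col V = m" using V by auto
  obtain Y where Y: "Y \<in> carrier_mat m m" "transpose_mat Y = Y" "fro_norm Y \<le> 1/2"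
    and YY: "Y + Y + Y * Y = transpose_mat V * V - 1\<^sub>m m"
    by (rule mat_sqrt_exists[OF _ _ near]) (use dV in \<open>auto simp: transpose_dims\<close>)
  define P where "P = 1\<^sub>m m + Y"
  have dP: "dim_row P = m" "dim_col P = m" using Y by (auto simp: P_def)
  have dY: "dim_row Y = m" "dim_col Y = m" using Y by auto
  have psdP: "psd_mat m P" unfolding P_def by (rule psd_id_plus) (use Y in auto)
  then have PT: "transpose_mat P = P" by (simp add: psd_mat_def sym_mat_def)
  have PP: "P * P = transpose_mat V * V"
  proof (rule eq_matI)
    fix i l assume "i < dim_row (transpose_mat V * V)" "l < dim_col (transpose_mat V * V)"
    then have il: "i < m" "l < m" by (simp_all add: dV)
    have "(P * P) $$ (i, l) = 1\<^sub>m m $$ (i, l) + (Y + Y + Y * Y) $$ (i, l)"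
      using il by (simp add: P_def mat_ring dY del: index_mult_mat(1))
    also have "\<dots> = (transpose_mat V * V) $$ (i, l)"
      unfolding YY using il by (simp add: dV del: index_mult_mat(1))
    finally show "(P * P) $$ (i, l) = (transpose_mat V * V) $$ (i, l)" .
  qed (simp_all add: dV dP)
  obtain B where B: "B \<in> carrier_mat m m" "P * B = 1\<^sub>m m" "B * P = 1\<^sub>m m"
    unfolding P_def by (rule id_plus_inverse[OF Y(1,3)])
  have dB: "dim_row B = m" "dim_col B = m" using B by auto
  \<comment> \<open>Transposing \<open>P * B = 1\<^sub>m m\<close> suffices here; symmetry of
    \<open>B\<close> need not be established.\<close>
  have BTP: "transpose_mat B * P = 1\<^sub>m m"
    using arg_cong[OF B(2), of transpose_mat] by (simp add: transpose_dims dB dP PT)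
  define Q where "Q = V * B"
  have Qc: "Q \<in> carrier_mat n m" using V B by (simp add: Q_def)
  have dQ: "dim_row Q = n" "dim_col Q = m" using Qc by auto
  have "transpose_mat Q * Q = transpose_mat B * (transpose_mat V * V) * B"
    by (simp add: Q_def mat_ring dV dB)
  also have "\<dots> = (transpose_mat B * P) * (P * B)"
    unfolding PP[symmetric] by (simp add: mat_ring dP dB)
  finally have QTQ: "transpose_mat Q * Q = 1\<^sub>m m"
    by (simp add: BTP B)
  have VQP: "V = Q * P"
    by (simp add: Q_def mat_ring dV dB dP B)
  have unique: "Q' = Q"
    if Q': "Q' \<in> carrier_mat n m" "transpose_mat Q' * Q' = 1\<^sub>m m"
      and P': "psd_mat m P'" "V = Q' * P'" for Q' P'
  proof -
    have dQ': "dim_row Q' = n" "dim_col Q' = m" using Q' by auto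
    have dP': "dim_row P' = m" "dim_col P' = m" and P'T: "transpose_mat P' = P'"
      using P' by (auto simp: psd_mat_def sym_mat_def)
    have "transpose_mat V * V = P' * (transpose_mat Q' * Q') * P'"
      unfolding P'(2) by (simp add: mat_ring dP' dQ' P'T)
    then have P'P': "P' * P' = P * P"
      by (simp add: Q' mat_ring dP' PP)
    \<comment> \<open>Both squares equal the Gram matrix, so
      \<open>P * D + D * P' = P * P - P' * P'\<close> vanishes. Paired with \<open>D\<close>, the
      first term is coercive and the second nonnegative, which forces \<open>D\<close> to be
      zero.\<close>
    define D where "D = P - P'"
    have dD: "dim_row D = m" "dim_col D = m" by (simp_all add: D_def dP')
    have "P * D + D * P' = P * P - P' * P'"
      by (rule eq_matI; simp add: D_def mat_ring dP dP' del: index_mult_mat(1))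
    also have "\<dots> = 0\<^sub>m m m" unfolding P'P' by (rule eq_matI; simp add: dP del: index_mult_mat(1))
    finally have "fro_inner D (P * D + D * P') = 0"
      by (simp add: fro_inner_def dD)
    then have "fro_inner D (P * D) + fro_inner D (D * P') = 0"
      by (simp add: fro_inner_add_right dD dP dP')
    moreover have "0 \<le> fro_inner D (D * P')"
    proof -
      have "fro_inner D (D * P') = fro_inner (transpose_mat D) (P' * transpose_mat D)"
        using fro_inner_transpose[of D "D * P'"] by (simp add: transpose_dims dD dP' P'T)
      then show ?thesis
        using psd_fro_inner_nonneg[OF P'(1), of "transpose_mat D"] dD by simp
    qed
    moreover have "(fro_norm D)\<^sup>2 / 2 \<le> fro_inner D (P * D)"
      unfolding P_def by (rule fro_inner_id_plus_ge[OF Y(1,3)]) (simp add: dD)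
    ultimately have "fro_norm D = 0"
      by (smt (verit) zero_less_power2 half_gt_zero)
    then have D0: "D = 0\<^sub>m m m" by (simp add: fro_norm_eq_0 dD)
    have "P = P'"
    proof (rule eq_matI)
      fix i l assume "i < dim_row P'" "l < dim_col P'"
      then show "P $$ (i, l) = P' $$ (i, l)"
        using arg_cong[OF D0, of "\<lambda>M. M $$ (i, l)"] by (simp add: D_def dP')
    qed (simp_all add: dP dP')
    then have "Q = Q' * (P * B)"
      by (simp add: Q_def P'(2) mat_ring dQ' dP' dB dP)
    then show ?thesis by (simp add: B mat_ring dQ')
  qed
  have "polar_factor V = Q"
    unfolding polar_factor_def dV
    by (rule the_equality) (use Qc QTQ VQP psdP unique in blast)+
  with that[OF _ _ Y] Qc QTQ VQP show ?thesis
    unfolding P_def by simp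
qed

section \<open>The optimal symmetric backward error\<close>

text \<open>The minimizer is the correction that vanishes on the orthogonal complement of the range
  of \<open>Q\<close>: every difference \<open>F\<close> of two feasible corrections is symmetric with \<open>F Q = 0\<close>, hence orthogonal to it.\<close>

lemma Least_sym_backward_error_le:
  assumes A: "A \<in> carrier_mat n n" "sym_mat A" and L: "L \<in> carrier_mat m m" "sym_mat L"
    and Q: "Q \<in> carrier_mat n m" "transpose_mat Q * Q = 1\<^sub>m m"
  shows "(LEAST x. x \<in> {fro_norm D | D. D \<in> carrier_mat n n \<and> sym_mat D \<and> (A + D) * Q = Q * L})
    \<le> (2 * sqrt m + sqrt m ^ 3) * fro_norm (A * Q - Q * L)" (is "Least ?S \<le> _")
proof -
  define R where "R = A * Q - Q * L"
  have d: "dim_row A = n" "dim_col A = n" "dim_row L = m" "dim_col L = m" "dim_row Q = n" "dim_col Q = m"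
    "dim_row R = n" "dim_col R = m"
    using A L Q by (auto simp: R_def)
  have sy: "transpose_mat A = A" "transpose_mat L = L"
    using A L by (auto simp: sym_mat_def)
  have QQ: "transpose_mat Q * (Q * Z) = Z" if "dim_row Z = m" for Z
    using mult_assoc_dims[of "transpose_mat Q" Q Z] that by (simp add: Q d mat_ring)
  \<comment> \<open>Feasibility means that the correction sends \<open>Q\<close> to
    \<open>-R\<close>. Symmetrizing \<open>- R * transpose_mat Q\<close> counts the part of
    \<open>R\<close> in the range of \<open>Q\<close> twice; the first term compensates for
    this.\<close>
  define D0 where "D0 = Q * (transpose_mat Q * (R * transpose_mat Q)) - R * transpose_mat Q - Q * transpose_mat R"
  have d0: "dim_row D0 = n" "dim_col D0 = n" by (simp_all add: D0_def d)
  \<comment> \<open>Both sides equal the symmetric matrix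
    \<open>transpose_mat Q * A * Q - L\<close>.\<close>
  have QR: "transpose_mat R * Q = transpose_mat Q * R"
    by (rule eq_matI; simp add: R_def mat_ring d sy QQ Q del: index_mult_mat(1))
  have sym0: "transpose_mat D0 = D0"
  proof -
    have "transpose_mat D0 = Q * (transpose_mat R * Q * transpose_mat Q) - Q * transpose_mat R - R * transpose_mat Q"
      by (simp add: D0_def mat_ring d)
    then show ?thesis
      unfolding QR D0_def
      by (intro eq_matI) (simp_all add: mat_ring d del: index_mult_mat(1))
  qed
  have D0Q: "D0 * Q = (- 1) \<cdot>\<^sub>m R"
    by (rule eq_matI; simp add: D0_def mat_ring d QR Q del: index_mult_mat(1))
  have feas0: "(A + D0) * Q = Q * L"
    by (rule eq_matI; simp add: mat_ring d d0 D0Q R_def del: index_mult_mat(1))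
  have minimal: "fro_norm D0 \<le> fro_norm D"
    if D: "D \<in> carrier_mat n n" "sym_mat D" "(A + D) * Q = Q * L" for D
  proof -
    have dD: "dim_row D = n" "dim_col D = n" using D by auto
    define F where "F = D - D0"
    have dF: "dim_row F = n" "dim_col F = n" by (simp_all add: F_def d0)
    have FT: "transpose_mat F = F"
      using D by (simp add: F_def transpose_dims dD d0 sym0 sym_mat_def)
    have "(A + D) * Q = (A + D0) * Q" by (simp add: D feas0)
    then have eq: "A * Q + D * Q = A * Q + D0 * Q" by (simp add: mat_ring d dD d0)
    have FQ: "F * Q = 0\<^sub>m n m"
    proof (rule eq_matI)
      fix i l assume "i < dim_row (0\<^sub>m n m :: real mat)" "l < dim_col (0\<^sub>m n m :: real mat)"
      then show "(F * Q) $$ (i, l) = 0\<^sub>m n m $$ (i, l)"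
        using arg_cong[OF eq, of "\<lambda>M. M $$ (i, l)"]
        by (simp add: F_def mat_ring d dD d0 del: index_mult_mat(1))
    qed (simp_all add: dF d)
    have QF: "transpose_mat Q * F = 0\<^sub>m m n"
      using arg_cong[OF FQ, of transpose_mat] by (simp add: transpose_dims dF d FT zero_transpose_mat)
    \<comment> \<open>Each term of \<open>D0\<close> has \<open>Q\<close> as left factor or its
      transpose as right factor, and moving that factor to \<open>F\<close> gives zero. Minimality
      then follows from Pythagoras.\<close>
    have "fro_inner D0 F = 0"
    proof -
      have "fro_inner (Q * Z) F = 0" if "dim_row Z = m" "dim_col Z = n" for Z
        using that by (subst fro_inner_mult_left) (simp_all add: d dF QF, simp add: fro_inner_def)
      moreover have "fro_inner (R * transpose_mat Q) F = 0"
        by (subst fro_inner_mult_right) (simp_all add: d dF FQ, simp add: fro_inner_def d)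
      ultimately show ?thesis
        by (simp add: D0_def fro_inner_linear d)
    qed
    moreover have "D = D0 + F"
      using dD d0 by (intro eq_matI) (auto simp: F_def)
    then have "fro_inner D D = fro_inner D0 D0 + 2 * fro_inner D0 F + fro_inner F F"
      by (simp add: fro_inner_linear fro_inner_add_right fro_inner_commute[of F D0] d0 dF)
    ultimately have "(fro_norm D)\<^sup>2 = (fro_norm D0)\<^sup>2 + (fro_norm F)\<^sup>2"
      by (simp add: fro_norm_square)
    then have "(fro_norm D0)\<^sup>2 \<le> (fro_norm D)\<^sup>2"
      using zero_le_power2[of "fro_norm F"] by linarith
    then show ?thesis
      using fro_norm_nonneg power2_le_imp_le by blast
  qed
  have "Least ?S = fro_norm D0"
  proof (rule Least_equality)
    show "fro_norm D0 \<in> {fro_norm D | D. D \<in> carrier_mat n n \<and> sym_mat D \<and> (A + D) * Q = Q * L}"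
      using feas0 sym0 d0 by (auto simp: sym_mat_def)
  qed (use minimal in blast)
  also have "\<dots> \<le> (2 * sqrt m + sqrt m ^ 3) * fro_norm R"
  proof -
    have "(fro_norm Q)\<^sup>2 = fro_inner (1\<^sub>m m) (1\<^sub>m m)"
    proof -
      have "(fro_norm Q)\<^sup>2 = fro_inner (Q * 1\<^sub>m m) Q"
        by (simp add: fro_norm_square mat_ring d)
      also have "\<dots> = fro_inner (1\<^sub>m m) (1\<^sub>m m)"
        by (subst fro_inner_mult_left) (simp_all add: d Q)
      finally show ?thesis .
    qed
    also have "\<dots> = (\<Sum>r<m. \<Sum>c<m. if r = c then 1 else 0)"
      unfolding fro_inner_def by (intro sum.cong) auto
    also have "\<dots> = m" by simp
    finally have q: "fro_norm Q = sqrt m"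
      by (metis fro_norm_nonneg real_sqrt_unique)
    have RQ: "fro_norm (R * transpose_mat Q) \<le> fro_norm R * sqrt m"
      using fro_norm_mult_le[of R "transpose_mat Q"] by (simp add: d fro_norm_transpose q)
    have QR': "fro_norm (Q * transpose_mat R) \<le> sqrt m * fro_norm R"
      using fro_norm_mult_le[of Q "transpose_mat R"] by (simp add: d fro_norm_transpose q)
    have "fro_norm (Q * (transpose_mat Q * (R * transpose_mat Q)))
        \<le> sqrt m * fro_norm (transpose_mat Q * (R * transpose_mat Q))"
      using fro_norm_mult_le[of Q "transpose_mat Q * (R * transpose_mat Q)"] by (simp add: d q)
    also have "\<dots> \<le> sqrt m * (sqrt m * fro_norm (R * transpose_mat Q))"
      using fro_norm_mult_le[of "transpose_mat Q" "R * transpose_mat Q"]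
      by (intro mult_left_mono) (simp_all add: d fro_norm_transpose q)
    also have "\<dots> \<le> sqrt m * (sqrt m * (fro_norm R * sqrt m))"
      by (intro mult_left_mono RQ) auto
    finally have QQRQ: "fro_norm (Q * (transpose_mat Q * (R * transpose_mat Q)))
        \<le> sqrt m ^ 3 * fro_norm R"
      by (simp add: power3_eq_cube ac_simps)
    have "fro_norm D0 \<le> fro_norm (Q * (transpose_mat Q * (R * transpose_mat Q)))
        + fro_norm (R * transpose_mat Q) + fro_norm (Q * transpose_mat R)"
      unfolding D0_def
      by (rule order_trans[OF fro_norm_minus_le add_mono[OF fro_norm_minus_le order_refl]])
        (simp_all add: d)
    also have "\<dots> \<le> sqrt m ^ 3 * fro_norm R + fro_norm R * sqrt m + sqrt m * fro_norm R"
      by (intro add_mono QQRQ RQ QR')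
    finally show ?thesis by (simp add: algebra_simps)
  qed
  finally show ?thesis by (simp add: R_def)
qed

section \<open>Perturbed deflation relations\<close>

text \<open>Multiplying the relation by \<open>transpose_mat V\<close> and subtracting the transpose
  of the result cancels the symmetric matrix \<open>transpose_mat V * A * V\<close>. What remains
  does not involve \<open>A\<close>.\<close>

lemma gram_commutator:
  assumes A: "A \<in> carrier_mat n n" "sym_mat A" and L: "L \<in> carrier_mat m m" "sym_mat L"
    and V: "V \<in> carrier_mat n m" and T: "T \<in> carrier_mat m m" and E: "E \<in> carrier_mat n m"
    and eq: "A * V + V * T = V * L + E" and G: "G = transpose_mat V * V"
  shows "G * L - L * G
    = G * T - transpose_mat T * G + (transpose_mat E * V - transpose_mat V * E)"
proof (rule eq_matI)
  let ?rhs = "G * T - transpose_mat T * G + (transpose_mat E * V - transpose_mat V * E)"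
  have d: "dim_row A = n" "dim_col A = n" "dim_row L = m" "dim_col L = m" "dim_row V = n" "dim_col V = m"
    "dim_row T = m" "dim_col T = m" "dim_row E = n" "dim_col E = m" "dim_row G = m" "dim_col G = m"
    using assms by auto
  have sy: "transpose_mat A = A" "transpose_mat L = L"
    using A L by (auto simp: sym_mat_def)
  have GT: "transpose_mat G = G" by (simp add: G transpose_dims d)
  show "dim_row (G * L - L * G) = dim_row ?rhs" "dim_col (G * L - L * G) = dim_col ?rhs"
    by (simp_all add: d)
  fix i l assume "i < dim_row ?rhs" "l < dim_col ?rhs"
  then have il: "i < m" "l < m" by (simp_all add: d)
  have 1: "transpose_mat V * (A * V) + G * T = G * L + transpose_mat V * E"
    using arg_cong[OF eq, of "\<lambda>M. transpose_mat V * M"] by (simp add: G mat_ring d)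
  have 2: "transpose_mat V * (A * V) + transpose_mat T * G = L * G + transpose_mat E * V"
    using arg_cong[OF 1, of transpose_mat] by (simp add: mat_ring d sy GT)
  show "(G * L - L * G) $$ (i, l) = ?rhs $$ (i, l)"
    using arg_cong[OF 1, of "\<lambda>M. M $$ (i, l)"] arg_cong[OF 2, of "\<lambda>M. M $$ (i, l)"] il
    by (simp add: d del: index_mult_mat(1))
qed

text \<open>With \<open>P = I + Y\<close> and \<open>P\<^sup>2 = G\<close>, the commutator \<open>K = [P, \<Lambda>]\<close> solves the Sylvester equation
  \<open>P K + K P = [G, \<Lambda>]\<close>, so it is controlled by \<open>[G, \<Lambda>]\<close>.\<close>

lemma commutator_sqrt_le:
  assumes Y: "Y \<in> carrier_mat m m" "fro_norm Y \<le> 1/2" and L: "L \<in> carrier_mat m m"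
    and G: "G = (1\<^sub>m m + Y) * (1\<^sub>m m + Y)"
  shows "fro_norm (Y * L - L * Y) \<le> fro_norm (G * L - L * G)"
proof -
  define K where "K = Y * L - L * Y"
  have d: "dim_row Y = m" "dim_col Y = m" "dim_row L = m" "dim_col L = m" "dim_row K = m" "dim_col K = m"
    using assms by (auto simp: K_def)
  \<comment> \<open>Here \<open>G\<close> is the identity plus \<open>2Y\<close> plus the square of
    \<open>Y\<close>, and the commutator with \<open>L\<close> obeys the product rule. The terms
    with \<open>Y\<close> have total norm at most that of \<open>K\<close> and are absorbed on the
    left.\<close>
  have "(2::real) \<cdot>\<^sub>m K = (G * L - L * G) - (Y * K + K * Y)"
    by (rule eq_matI; simp add: G K_def mat_ring d del: index_mult_mat(1))
  then have "2 * fro_norm K = fro_norm ((G * L - L * G) - (Y * K + K * Y))"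
    by (metis abs_numeral fro_norm_smult)
  also have "\<dots> \<le> fro_norm (G * L - L * G) + (fro_norm Y * fro_norm K + fro_norm K * fro_norm Y)"
    by (rule order_trans[OF fro_norm_minus_le add_left_mono[OF
            order_trans[OF fro_norm_add_le add_mono[OF fro_norm_mult_le fro_norm_mult_le]]]])
      (simp_all add: d G)
  also have "\<dots> \<le> fro_norm (G * L - L * G) + (1/2 * fro_norm K + fro_norm K * (1/2))"
    by (intro add_mono mult_mono Y order_refl fro_norm_nonneg) auto
  finally show ?thesis by (simp add: K_def)
qed

text \<open>Substituting \<open>V = Q + Q * Y\<close> into the relation turns it into an equation
  for the residual \<open>R\<close> of \<open>Q\<close> whose only implicit term is
  \<open>R * Y\<close>. As \<open>Y\<close> has norm at most 1/2, this term is absorbed, at the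
  price of the factor 2. The quantity \<open>e\<close> bounds the commutator of \<open>Y\<close> and
  \<open>L\<close>.\<close>

lemma polar_residual_le:
  assumes A: "A \<in> carrier_mat n n" "sym_mat A" and L: "L \<in> carrier_mat m m" "sym_mat L"
    and V: "V \<in> carrier_mat n m" and T: "T \<in> carrier_mat m m" and E: "E \<in> carrier_mat n m"
    and eq: "A * V + V * T = V * L + E"
    and Q: "Q \<in> carrier_mat n m" "transpose_mat Q * Q = 1\<^sub>m m"
    and Y: "Y \<in> carrier_mat m m" "transpose_mat Y = Y" "fro_norm Y \<le> 1/2"
    and V_eq: "V = Q * (1\<^sub>m m + Y)"
  defines "e \<equiv> 2 * (fro_norm V)\<^sup>2 * fro_norm T + 2 * fro_norm V * fro_norm E"
  shows "fro_norm (A * Q - Q * L) \<le> 2 * (fro_norm Q * e + fro_norm V * fro_norm T + fro_norm E)"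
proof -
  define G where "G = transpose_mat V * V"
  define K where "K = Y * L - L * Y"
  define R where "R = A * Q - Q * L"
  have d: "dim_row A = n" "dim_col A = n" "dim_row L = m" "dim_col L = m" "dim_row V = n" "dim_col V = m"
    "dim_row T = m" "dim_col T = m" "dim_row E = n" "dim_col E = m" "dim_row G = m" "dim_col G = m"
    "dim_row Q = n" "dim_col Q = m" "dim_row Y = m" "dim_col Y = m" "dim_row K = m" "dim_col K = m"
    "dim_row R = n" "dim_col R = m"
    using assms by (auto simp: G_def K_def R_def)
  have nn: "0 \<le> fro_norm M" for M by (rule fro_norm_nonneg)
  have "G = (1\<^sub>m m + Y) * (transpose_mat Q * Q) * (1\<^sub>m m + Y)"
    unfolding G_def V_eq by (simp add: mat_ring d Y)
  then have GP: "G = (1\<^sub>m m + Y) * (1\<^sub>m m + Y)"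
    by (simp add: Q one_mult_dims d)
  have G: "fro_norm G \<le> (fro_norm V)\<^sup>2"
    using fro_norm_mult_le[of "transpose_mat V" V]
    by (simp add: G_def fro_norm_transpose power2_eq_square)
  have "fro_norm K \<le> fro_norm (G * L - L * G)"
    unfolding K_def by (rule commutator_sqrt_le[OF Y(1,3) L(1) GP])
  also have "G * L - L * G
      = G * T - transpose_mat T * G + (transpose_mat E * V - transpose_mat V * E)"
    by (rule gram_commutator[OF A L V T E eq G_def])
  also have "fro_norm \<dots> \<le> (fro_norm G * fro_norm T + fro_norm (transpose_mat T) * fro_norm G)
      + (fro_norm (transpose_mat E) * fro_norm V + fro_norm (transpose_mat V) * fro_norm E)"
    by (rule order_trans[OF fro_norm_add_le add_mono[OF
            order_trans[OF fro_norm_minus_le add_mono[OF fro_norm_mult_le fro_norm_mult_le]]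
            order_trans[OF fro_norm_minus_le add_mono[OF fro_norm_mult_le fro_norm_mult_le]]]])
      (simp_all add: d)
  also have "\<dots> = 2 * (fro_norm G * fro_norm T) + 2 * fro_norm V * fro_norm E"
    by (simp add: fro_norm_transpose)
  also have "\<dots> \<le> e"
    unfolding e_def using mult_right_mono[OF G nn[of T]] by simp
  finally have K: "fro_norm K \<le> e" .
  \<comment> \<open>The term \<open>A * (Q * Y)\<close> is rewritten through
    \<open>A * Q = R + Q * L\<close>, so \<open>A\<close> occurs only inside \<open>R\<close> and
    the diagonal matrix only inside \<open>R\<close> and \<open>K\<close>.\<close>
  have "R = (Q * K - V * T + E) - R * Y"
  proof (rule eq_matI)
    fix i l assume "i < dim_row (Q * K - V * T + E - R * Y)" "l < dim_col (Q * K - V * T + E - R * Y)"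
    then have il: "i < n" "l < m" by (simp_all add: d)
    have "(A * V + V * T) $$ (i, l) = (V * L + E) $$ (i, l)" by (simp add: eq)
    moreover have "A * V = A * Q + A * (Q * Y)" "V * L = Q * L + Q * (Y * L)"
      unfolding V_eq by (simp_all add: mat_ring d)
    ultimately have "(A * Q) $$ (i, l) + (A * (Q * Y)) $$ (i, l) + (V * T) $$ (i, l)
        = (Q * L) $$ (i, l) + (Q * (Y * L)) $$ (i, l) + E $$ (i, l)"
      using il by (simp add: d del: index_mult_mat(1))
    then show "R $$ (i, l) = (Q * K - V * T + E - R * Y) $$ (i, l)"
      using il by (simp add: R_def K_def mat_ring d del: index_mult_mat(1))
  qed (simp_all add: d)
  then have "fro_norm R = fro_norm ((Q * K - V * T + E) - R * Y)" by simp
  also have "\<dots> \<le> ((fro_norm Q * fro_norm K + fro_norm V * fro_norm T) + fro_norm E) + fro_norm R * fro_norm Y"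
    by (rule order_trans[OF fro_norm_minus_le add_mono[OF order_trans[OF fro_norm_add_le add_mono[OF
            order_trans[OF fro_norm_minus_le add_mono[OF fro_norm_mult_le fro_norm_mult_le]] order_refl]]
            fro_norm_mult_le]])
      (simp_all add: d)
  also have "\<dots> \<le> ((fro_norm Q * e + fro_norm V * fro_norm T) + fro_norm E) + fro_norm R * (1/2)"
    by (intro add_mono mult_left_mono K Y order_refl nn)
  finally show ?thesis by (simp add: R_def)
qed

section \<open>Inexact explicit external deflation\<close>

lemma V_mat_dims [simp]: "dim_row (V_mat n v m) = n" "dim_col (V_mat n v m) = m"
  by (simp_all add: V_mat_def)

lemma V_mat_index:
  assumes "r < n" "l < m"
  shows "V_mat n v m $$ (r, l) = v (Suc l) $ r"
  using assms by (simp add: V_mat_def mat_of_cols_index del: upt_Suc)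

lemma col_V_mat:
  assumes "l < m" "v (Suc l) \<in> carrier_vec n"
  shows "col (V_mat n v m) l = v (Suc l)"
  using assms by (intro eq_vecI) (auto simp: V_mat_index)

lemma V_mat_gram_index:
  assumes "k < m" "l < m" "v (Suc k) \<in> carrier_vec n" "w (Suc l) \<in> carrier_vec n"
  shows "(transpose_mat (V_mat n v m) * V_mat n w m) $$ (k, l) = v (Suc k) \<bullet> w (Suc l)"
  using assms by (simp add: col_V_mat)

text \<open>Applied to the unit columns with bound 1 and to the residual columns with the residual
  bound.\<close>

lemma fro_norm_V_mat_le:
  assumes "\<And>l. l < m \<Longrightarrow> v (Suc l) \<in> carrier_vec n \<and> vec_norm2 (v (Suc l)) \<le> b" "0 \<le> b"
  shows "fro_norm (V_mat n v m) \<le> sqrt m * b"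
proof -
  have "(fro_norm (V_mat n v m))\<^sup>2 = (\<Sum>l<m. v (Suc l) \<bullet> v (Suc l))"
    using assms(1) by (simp add: fro_norm_square fro_inner_cols col_V_mat)
  also have "\<dots> \<le> (\<Sum>l<m. b\<^sup>2)"
  proof (rule sum_mono)
    fix l assume "l \<in> {..<m}"
    then have "vec_norm2 (v (Suc l)) \<le> b" using assms(1) by auto
    then show "v (Suc l) \<bullet> v (Suc l) \<le> b\<^sup>2"
      unfolding vec_norm2_def by (rule sqrt_le_D)
  qed
  also have "\<dots> = (sqrt m * b)\<^sup>2" by (simp add: power_mult_distrib)
  finally show ?thesis
    by (rule power2_le_imp_le) (simp add: assms(2))
qed

text \<open>Padding with zeros to the full square turns sums over \<open>k < p < l\<close> into
  ordinary matrix products. Indices start at 0 here, so \<open>k\<close> stands for the vector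
  numbered \<open>Suc k\<close>.\<close>

definition strict_upper_norm :: "(nat \<Rightarrow> nat \<Rightarrow> real) \<Rightarrow> nat \<Rightarrow> real" where
  "strict_upper_norm g i = L2_set (\<lambda>(k, l). if k < l then \<bar>g k l\<bar> else 0) ({..<i} \<times> {..<i})"

lemma strict_upper_norm_nonneg: "0 \<le> strict_upper_norm g i"
  by (simp add: strict_upper_norm_def L2_set_nonneg)

text \<open>Unit columns make the diagonal of the difference vanish, and symmetry counts each
  remaining entry twice.\<close>

lemma orth_loss_strict_upper:
  assumes v: "\<And>l. l < i \<Longrightarrow> v (Suc l) \<in> carrier_vec n \<and> vec_norm2 (v (Suc l)) = 1"
  shows "orth_loss n v i = sqrt 2 * strict_upper_norm (\<lambda>k l. v (Suc k) \<bullet> v (Suc l)) i"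
proof -
  define a where "a k l = (if k < l then (v (Suc k) \<bullet> v (Suc l))\<^sup>2 else 0)" for k l
  have entry: "((transpose_mat (V_mat n v i) * V_mat n v i - 1\<^sub>m i) $$ (k, l))\<^sup>2 = a k l + a l k"
    if "k < i" "l < i" for k l
  proof -
    have "v (Suc k) \<bullet> v (Suc l) = v (Suc l) \<bullet> v (Suc k)"
      using v that by (intro comm_scalar_prod) auto
    moreover have "v (Suc k) \<bullet> v (Suc k) = 1"
      using v[OF that(1)] by (simp add: vec_norm2_def)
    moreover have "(transpose_mat (V_mat n v i) * V_mat n v i - 1\<^sub>m i) $$ (k, l)
        = v (Suc k) \<bullet> v (Suc l) - (if k = l then 1 else 0)"
      using that v by (simp add: V_mat_gram_index del: index_mult_mat(1))
    ultimately show ?thesis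
      by (cases k l rule: linorder_cases) (simp_all add: a_def)
  qed
  have "orth_loss n v i = sqrt (\<Sum>k<i. \<Sum>l<i. a k l + a l k)"
    unfolding orth_loss_def fro_norm_def by (simp add: entry del: index_mult_mat(1) index_minus_mat(1))
  also have "(\<Sum>k<i. \<Sum>l<i. a k l + a l k) = 2 * (\<Sum>k<i. \<Sum>l<i. a k l)"
    by (simp add: sum.distrib sum.swap[of "\<lambda>k l. a l k"])
  also have "(\<Sum>k<i. \<Sum>l<i. a k l) = (\<Sum>(k, l)\<in>{..<i} \<times> {..<i}. (if k < l then \<bar>v (Suc k) \<bullet> v (Suc l)\<bar> else 0)\<^sup>2)"
    unfolding sum.cartesian_product by (rule sum.cong) (auto simp: a_def)
  finally show ?thesis
    by (simp add: strict_upper_norm_def L2_set_def real_sqrt_mult case_prod_unfold)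
qed

lemma L2_set_subset_mono:
  assumes "finite B" "A \<subseteq> B"
  shows "L2_set f A \<le> L2_set f B"
  unfolding L2_set_def using assms by (intro real_sqrt_le_mono sum_mono2) auto

text \<open>The left factor of the product sum only involves columns below \<open>i\<close>. So the quadratic
  recursion becomes linear in the norm at \<open>Suc i\<close>, and no root selection is needed.\<close>

lemma strict_upper_norm_Suc_le:
  fixes g :: "nat \<Rightarrow> nat \<Rightarrow> real" and S :: "real mat"
  assumes S: "S \<in> carrier_mat (Suc i) (Suc i)" and c: "0 \<le> c" "0 \<le> d"
    and le: "\<And>k l. k < l \<Longrightarrow> l < Suc i \<Longrightarrow>
      \<bar>g k l\<bar> \<le> c * (\<Sum>p\<in>{k<..<l}. \<bar>g k p\<bar> * \<bar>g p l\<bar>) + d * (\<bar>S $$ (l, k)\<bar> + \<bar>S $$ (k, l)\<bar>)"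
  shows "strict_upper_norm g (Suc i)
    \<le> c * (strict_upper_norm g i * strict_upper_norm g (Suc i)) + 2 * d * fro_norm S"
proof -
  define a where "a k l = (if k < l then \<bar>g k l\<bar> else 0)" for k l
  let ?I = "{..<Suc i} \<times> {..<Suc i}"
  have a_nonneg: "0 \<le> a k l" for k l by (simp add: a_def)
  have norm_a: "strict_upper_norm g r = L2_set (\<lambda>(k, l). a k l) ({..<r} \<times> {..<r})" for r
    by (simp add: strict_upper_norm_def a_def)
  have entry: "a k l \<le> c * (\<Sum>p<i. a k p * a p l) + d * (\<bar>S $$ (l, k)\<bar> + \<bar>S $$ (k, l)\<bar>)"
    if "k < Suc i" "l < Suc i" for k l
  proof (cases "k < l")
    case True
    \<comment> \<open>The padded factors vanish outside \<open>k < p < l\<close>, and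
      \<open>l \<le> i\<close> keeps every such \<open>p\<close> below \<open>i\<close>.\<close>
    have "(\<Sum>p\<in>{k<..<l}. \<bar>g k p\<bar> * \<bar>g p l\<bar>) = (\<Sum>p<i. a k p * a p l)"
      using that True by (intro sum.mono_neutral_cong_left) (auto simp: a_def)
    then show ?thesis
      using le[OF True that(2)] True by (simp add: a_def)
  next
    case False
    have "0 \<le> (\<Sum>p<i. a k p * a p l)"
      by (intro sum_nonneg mult_nonneg_nonneg) (auto simp: a_def)
    then show ?thesis using False c by (simp add: a_def)
  qed
  have "strict_upper_norm g (Suc i)
      \<le> L2_set (\<lambda>(k, l). c * (\<Sum>p<i. a k p * a p l) + d * (\<bar>S $$ (l, k)\<bar> + \<bar>S $$ (k, l)\<bar>)) ?I"
    unfolding norm_a by (rule L2_set_mono) (use entry a_nonneg in auto)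
  also have "\<dots> \<le> L2_set (\<lambda>(k, l). c * (\<Sum>p<i. a k p * a p l)) ?I
      + L2_set (\<lambda>(k, l). d * (\<bar>S $$ (l, k)\<bar> + \<bar>S $$ (k, l)\<bar>)) ?I"
    using L2_set_triangle_ineq[of "\<lambda>(k, l). c * (\<Sum>p<i. a k p * a p l)"
        "\<lambda>(k, l). d * (\<bar>S $$ (l, k)\<bar> + \<bar>S $$ (k, l)\<bar>)" ?I]
    by (simp add: case_prod_unfold)
  also have "L2_set (\<lambda>(k, l). c * (\<Sum>p<i. a k p * a p l)) ?I
      = c * L2_set (\<lambda>(k, l). \<Sum>p<i. a k p * a p l) ?I"
    using c L2_set_right_distrib[of c "\<lambda>(k, l). \<Sum>p<i. a k p * a p l" ?I]
    by (simp add: case_prod_unfold)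
  also have "L2_set (\<lambda>(k, l). d * (\<bar>S $$ (l, k)\<bar> + \<bar>S $$ (k, l)\<bar>)) ?I
      = d * L2_set (\<lambda>(k, l). \<bar>S $$ (l, k)\<bar> + \<bar>S $$ (k, l)\<bar>) ?I"
    using c L2_set_right_distrib[of d "\<lambda>(k, l). \<bar>S $$ (l, k)\<bar> + \<bar>S $$ (k, l)\<bar>" ?I]
    by (simp add: case_prod_unfold)
  also have "L2_set (\<lambda>(k, l). \<bar>S $$ (l, k)\<bar> + \<bar>S $$ (k, l)\<bar>) ?I
      \<le> L2_set (\<lambda>(k, l). \<bar>S $$ (l, k)\<bar>) ?I + L2_set (\<lambda>(k, l). \<bar>S $$ (k, l)\<bar>) ?I"
    using L2_set_triangle_ineq[of "\<lambda>(k, l). \<bar>S $$ (l, k)\<bar>" "\<lambda>(k, l). \<bar>S $$ (k, l)\<bar>" ?I]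
    by (simp add: case_prod_unfold)
  also have "L2_set (\<lambda>(k, l). \<bar>S $$ (k, l)\<bar>) ?I = fro_norm S"
    using S by (simp add: fro_norm_L2 L2_set_def case_prod_unfold)
  also have "L2_set (\<lambda>(k, l). \<bar>S $$ (l, k)\<bar>) ?I = fro_norm (transpose_mat S)"
    using S unfolding fro_norm_L2 L2_set_def by (auto intro!: arg_cong[of _ _ sqrt] sum.cong)
  also have "\<dots> = fro_norm S" by (rule fro_norm_transpose)
  also have "L2_set (\<lambda>(k, l). \<Sum>p<i. a k p * a p l) ?I
      \<le> L2_set (\<lambda>(k, l). a k l) ({..<Suc i} \<times> {..<i}) * L2_set (\<lambda>(k, l). a k l) ({..<i} \<times> {..<Suc i})"
    by (rule L2_set_matrix_mult)
  \<comment> \<open>The additional row \<open>i\<close> is zero, because its columns lie below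
    \<open>i\<close>.\<close>
  also have "L2_set (\<lambda>(k, l). a k l) ({..<Suc i} \<times> {..<i}) = strict_upper_norm g i"
    unfolding norm_a L2_set_def
    by (intro arg_cong[of _ _ sqrt] sum.mono_neutral_right) (auto simp: a_def split: if_splits)
  also have "L2_set (\<lambda>(k, l). a k l) ({..<i} \<times> {..<Suc i}) \<le> strict_upper_norm g (Suc i)"
    unfolding norm_a by (rule L2_set_subset_mono) auto
  finally have "strict_upper_norm g (Suc i)
      \<le> c * (strict_upper_norm g i * strict_upper_norm g (Suc i)) + d * (fro_norm S + fro_norm S)"
    using c by (simp add: mult_left_mono strict_upper_norm_nonneg)
  then show ?thesis by (simp add: algebra_simps)
qed

section \<open>From the deflation steps to a bound on the Gram matrix\<close>

lemma deflated_mult_index: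
  assumes "A \<in> carrier_mat n n" "x \<in> carrier_vec n" "r < n" "\<And>k. 1 \<le> k \<Longrightarrow> k \<le> i \<Longrightarrow> v k \<in> carrier_vec n"
  shows "(deflated n A \<sigma> v i *\<^sub>v x) $ r = (A *\<^sub>v x) $ r + (\<Sum>k=1..i. v k $ r * (\<sigma> k * (v k \<bullet> x)))"
proof -
  have "(deflated n A \<sigma> v i *\<^sub>v x) $ r
      = (\<Sum>c<n. (A $$ (r, c) + (\<Sum>k=1..i. \<sigma> k * (v k $ r * v k $ c))) * x $ c)"
    using assms by (simp add: deflated_def scalar_prod_def atLeast0LessThan)
  also have "\<dots> = (\<Sum>c<n. A $$ (r, c) * x $ c)
      + (\<Sum>c<n. \<Sum>k=1..i. \<sigma> k * (v k $ r * v k $ c) * x $ c)"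
    by (simp add: distrib_right sum.distrib sum_distrib_right)
  also have "(\<Sum>c<n. \<Sum>k=1..i. \<sigma> k * (v k $ r * v k $ c) * x $ c)
      = (\<Sum>k=1..i. \<Sum>c<n. \<sigma> k * (v k $ r * v k $ c) * x $ c)"
    by (rule sum.swap)
  also have "\<dots> = (\<Sum>k=1..i. v k $ r * (\<sigma> k * (v k \<bullet> x)))"
    using assms by (intro sum.cong)
      (auto simp: scalar_prod_def atLeast0LessThan sum_distrib_left ac_simps)
  finally show ?thesis
    using assms by (simp add: scalar_prod_def atLeast0LessThan)
qed

text \<open>Column \<open>l\<close> is the step that determines \<open>v (Suc l)\<close>. Only the
  vectors numbered 1 to \<open>l\<close> have been deflated by then, which makes \<open>T\<close>
  strictly upper triangular.\<close>

lemma eed_matrix_eq: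
  assumes A: "A \<in> carrier_mat n n" and steps: "eed_steps n A j \<sigma> lam v \<eta>"
  defines "T \<equiv> mat (j+1) (j+1) (\<lambda>(k, l). if k < l then \<sigma> (Suc k) * (v (Suc k) \<bullet> v (Suc l)) else 0)"
  shows "A * V_mat n v (j+1) + V_mat n v (j+1) * T
    = V_mat n v (j+1) * Lambda_mat lam (j+1) + V_mat n \<eta> (j+1)" (is "?L = ?R")
proof (rule eq_matI)
  have v: "v k \<in> carrier_vec n" if "1 \<le> k" "k \<le> j+1" for k
    using steps that by (auto simp: eed_steps_def)
  have dL: "dim_row (Lambda_mat lam (j+1)) = j+1" "dim_col (Lambda_mat lam (j+1)) = j+1"
    by (simp_all add: Lambda_mat_def mat_diag_def)
  have dT: "dim_row T = j+1" "dim_col T = j+1" by (simp_all add: T_def)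
  show "dim_row ?L = dim_row ?R" "dim_col ?L = dim_col ?R" using A by (simp_all add: dT)
  fix r l assume "r < dim_row ?R" "l < dim_col ?R"
  then have r: "r < n" and l: "l < j+1" by simp_all
  have \<eta>: "\<eta> (Suc l) \<in> carrier_vec n"
    using steps l by (auto simp: eed_steps_def)
  have "deflated n A \<sigma> v l *\<^sub>v v (Suc l) = lam (Suc l) \<cdot>\<^sub>v v (Suc l) + \<eta> (Suc l)"
    using steps l by (auto simp: eed_steps_def)
  from arg_cong[OF this, of "\<lambda>x. x $ r"]
  have "(A *\<^sub>v v (Suc l)) $ r + (\<Sum>k=1..l. v k $ r * (\<sigma> k * (v k \<bullet> v (Suc l))))
      = lam (Suc l) * v (Suc l) $ r + \<eta> (Suc l) $ r"
    using l r carrier_vecD[OF v[of "Suc l"]] v \<eta> by (simp add: deflated_mult_index[OF A])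
  moreover have "(V_mat n v (j+1) * T) $$ (r, l) = (\<Sum>k=1..l. v k $ r * (\<sigma> k * (v k \<bullet> v (Suc l))))"
  proof -
    have "(V_mat n v (j+1) * T) $$ (r, l)
        = (\<Sum>k<j+1. v (Suc k) $ r * (if k < l then \<sigma> (Suc k) * (v (Suc k) \<bullet> v (Suc l)) else 0))"
      using r l by (simp add: index_mult_mat_sum dT V_mat_index T_def del: index_mult_mat(1))
    also have "\<dots> = (\<Sum>k<l. v (Suc k) $ r * (\<sigma> (Suc k) * (v (Suc k) \<bullet> v (Suc l))))"
      using l by (intro sum.mono_neutral_cong_right) auto
    finally show ?thesis
      by (simp add: sum.atLeast1_atMost_eq)
  qed
  moreover have "(A * V_mat n v (j+1)) $$ (r, l) = (A *\<^sub>v v (Suc l)) $ r"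
    using A r l v[of "Suc l"] by (simp add: col_V_mat)
  moreover have "(V_mat n v (j+1) * Lambda_mat lam (j+1)) $$ (r, l) = lam (Suc l) * v (Suc l) $ r"
    unfolding Lambda_mat_def using r l
    by (subst mat_diag_mult_right[of _ n]) (auto simp: V_mat_index intro!: carrier_matI)
  ultimately show "?L $$ (r, l) = ?R $$ (r, l)"
    using r l by (simp add: dT dL V_mat_index del: index_mult_mat(1))
qed

lemma Lambda_mat_dims [simp]:
  "dim_row (Lambda_mat lam m) = m" "dim_col (Lambda_mat lam m) = m"
  by (simp_all add: Lambda_mat_def mat_diag_def)

lemma sym_Lambda_mat: "sym_mat (Lambda_mat lam m)"
  unfolding sym_mat_def Lambda_mat_def mat_diag_def by (rule eq_matI) auto

lemma Lambda_mat_mult_index: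
  assumes "dim_row M = m" "dim_col M = m" "k < m" "l < m"
  shows "(M * Lambda_mat lam m) $$ (k, l) = M $$ (k, l) * lam (Suc l)"
    and "(Lambda_mat lam m * M) $$ (k, l) = lam (Suc k) * M $$ (k, l)"
  unfolding Lambda_mat_def using assms
  by (subst mat_diag_mult_right[of _ m] mat_diag_mult_left[of _ m m]; auto intro!: carrier_matI)+

text \<open>Entry \<open>(k, l)\<close> of the commutator identity: the two triangular products have
  terms \<open>p < l\<close> and \<open>p < k\<close>, so the terms below \<open>k\<close> cancel.
  The term \<open>p = k\<close> contains \<open>g k k = 1\<close>; moved to the left it shifts the
  eigenvalue difference to one that the spectral gap bounds from below.\<close>

lemma eed_offdiag_eq:
  assumes A: "A \<in> carrier_mat n n" "sym_mat A" and steps: "eed_steps n A j \<sigma> lam v \<eta>"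
    and kl: "k < l" "l < j + 1"
  shows "(lam (Suc l) - (lam (Suc k) + \<sigma> (Suc k))) * (v (Suc k) \<bullet> v (Suc l))
    = (\<Sum>p\<in>{k<..<l}. \<sigma> (Suc p) * ((v (Suc k) \<bullet> v (Suc p)) * (v (Suc p) \<bullet> v (Suc l))))
      + (v (Suc l) \<bullet> \<eta> (Suc k) - v (Suc k) \<bullet> \<eta> (Suc l))"
proof -
  define m where "m = j + 1"
  define V where "V = V_mat n v m"
  define E where "E = V_mat n \<eta> m"
  define L where "L = Lambda_mat lam m"
  define g where "g a b = v (Suc a) \<bullet> v (Suc b)" for a b
  define T where "T = mat m m (\<lambda>(k, l). if k < l then \<sigma> (Suc k) * g k l else 0)"
  define G where "G = transpose_mat V * V"
  have v: "v (Suc i) \<in> carrier_vec n" "vec_norm2 (v (Suc i)) = 1" "\<eta> (Suc i) \<in> carrier_vec n" if "i < m" for i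
    using steps that by (auto simp: eed_steps_def m_def)
  have lm: "k < m" "l < m" using kl by (simp_all add: m_def)
  have d: "dim_row T = m" "dim_col T = m" "dim_row V = n" "dim_col V = m" "dim_row E = n" "dim_col E = m"
    "dim_row L = m" "dim_col L = m" "dim_row G = m" "dim_col G = m"
    by (simp_all add: T_def V_def E_def L_def G_def)
  have Gi: "G $$ (a, b) = g a b" if "a < m" "b < m" for a b
    using that v by (simp add: G_def V_def g_def V_mat_gram_index del: index_mult_mat(1))
  have gsym: "g a b = g b a" if "a < m" "b < m" for a b
    using that v unfolding g_def by (intro comm_scalar_prod) auto
  have "A * V + V * T = V * L + E"
    unfolding V_def E_def L_def T_def g_def m_def by (rule eed_matrix_eq[OF A(1) steps])
  then have "G * L - L * G = G * T - transpose_mat T * G + (transpose_mat E * V - transpose_mat V * E)"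
    by (intro gram_commutator[of A n L m])
      (use A d in \<open>auto simp: L_def sym_Lambda_mat G_def intro!: carrier_matI\<close>)
  from arg_cong[OF this, of "\<lambda>M. M $$ (k, l)"]
  have "(G * L) $$ (k, l) - (L * G) $$ (k, l) = (G * T) $$ (k, l) - (transpose_mat T * G) $$ (k, l)
      + ((transpose_mat E * V) $$ (k, l) - (transpose_mat V * E) $$ (k, l))"
    using lm by (simp add: d del: index_mult_mat(1))
  moreover have "(G * L) $$ (k, l) - (L * G) $$ (k, l) = (lam (Suc l) - lam (Suc k)) * g k l"
    unfolding L_def using lm by (simp add: Lambda_mat_mult_index d Gi algebra_simps del: index_mult_mat(1))
  moreover have "(transpose_mat V * E) $$ (k, l) = v (Suc k) \<bullet> \<eta> (Suc l)"
    using lm v by (simp add: V_def E_def V_mat_gram_index del: index_mult_mat(1))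
  moreover have "(transpose_mat E * V) $$ (k, l) = v (Suc l) \<bullet> \<eta> (Suc k)"
    using lm v comm_scalar_prod[of "\<eta> (Suc k)" n "v (Suc l)"]
    by (simp add: V_def E_def V_mat_gram_index del: index_mult_mat(1))
  moreover have "(G * T) $$ (k, l) = (\<Sum>p<l. \<sigma> (Suc p) * (g k p * g p l))"
  proof -
    have "(G * T) $$ (k, l) = (\<Sum>p<m. g k p * (if p < l then \<sigma> (Suc p) * g p l else 0))"
      using lm by (simp add: index_mult_mat_sum d Gi T_def del: index_mult_mat(1))
    also have "\<dots> = (\<Sum>p<l. \<sigma> (Suc p) * (g k p * g p l))"
      using lm by (intro sum.mono_neutral_cong_right) auto
    finally show ?thesis .
  qed
  moreover have "(transpose_mat T * G) $$ (k, l) = (\<Sum>p<k. \<sigma> (Suc p) * (g k p * g p l))"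
  proof -
    have "(transpose_mat T * G) $$ (k, l) = (\<Sum>p<m. (if p < k then \<sigma> (Suc p) * g p k else 0) * g p l)"
      using lm by (simp add: index_mult_mat_sum d Gi T_def del: index_mult_mat(1))
    also have "\<dots> = (\<Sum>p<k. \<sigma> (Suc p) * (g k p * g p l))"
      using lm gsym[of _ k] by (intro sum.mono_neutral_cong_right) auto
    finally show ?thesis .
  qed
  moreover have "(\<Sum>p<l. \<sigma> (Suc p) * (g k p * g p l)) = (\<Sum>p<k. \<sigma> (Suc p) * (g k p * g p l))
      + \<sigma> (Suc k) * g k l + (\<Sum>p\<in>{k<..<l}. \<sigma> (Suc p) * (g k p * g p l))"
  proof -
    have split: "{..<l} = insert k {..<k} \<union> {k<..<l}" using kl by auto
    have "g k k = 1" using v(2)[OF lm(1)] by (simp add: g_def vec_norm2_def)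
    then show ?thesis
      unfolding split by (subst sum.union_disjoint) auto
  qed
  ultimately show ?thesis
    unfolding g_def[symmetric] by (simp add: algebra_simps)
qed

text \<open>Induction on the number of columns. With \<open>u\<close> the norm at
  \<open>Suc i\<close> and \<open>\<epsilon>\<close> the scaled residual, the estimates give
  \<open>u \<le> u/16 + 2 * \<epsilon> + 3/80 * u\<close>. Hence 9/10 of \<open>u\<close> is at most
  \<open>2 * \<epsilon>\<close>, and the factor 20/9 is below the claimed 5/2.\<close>

lemma eed_strict_upper_norm_le:
  assumes A: "A \<in> carrier_mat n n" "sym_mat A" and steps: "eed_steps n A j \<sigma> lam v \<eta>"
    and \<gamma>: "0 < \<gamma>" "\<And>k l. k < j \<Longrightarrow> l < j + 1 \<Longrightarrow> \<gamma> \<le> \<bar>lam (Suc l) - (lam (Suc k) + \<sigma> (Suc k))\<bar>"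
    and \<sigma>: "\<And>k. k < j \<Longrightarrow> \<bar>\<sigma> (Suc k)\<bar> \<le> \<tau> * \<gamma>" and \<tau>: "1 \<le> \<tau>"
    and res: "\<And>k. k < j + 1 \<Longrightarrow> vec_norm2 (\<eta> (Suc k)) \<le> t" "0 \<le> t"
    and small: "\<tau> * (sqrt (j + 1) * t / \<gamma>) \<le> 1/40"
    and i: "i \<le> j + 1"
  shows "strict_upper_norm (\<lambda>k l. v (Suc k) \<bullet> v (Suc l)) i \<le> 5/2 * (sqrt (j + 1) * t / \<gamma>)"
  using i
proof (induction i)
  case 0
  show ?case using res(2) \<gamma>(1) by (simp add: strict_upper_norm_def)
next
  case (Suc i)
  define g where "g k l = v (Suc k) \<bullet> v (Suc l)" for k l
  define \<epsilon> where "\<epsilon> = sqrt (j + 1) * t / \<gamma>"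
  define u where "u = strict_upper_norm g (Suc i)"
  define V where "V = V_mat n v (Suc i)"
  define E where "E = V_mat n \<eta> (Suc i)"
  define S where "S = transpose_mat V * E"
  have u0: "0 \<le> u" by (simp add: u_def strict_upper_norm_nonneg)
  have \<epsilon>0: "0 \<le> \<epsilon>" using res(2) \<gamma>(1) by (simp add: \<epsilon>_def)
  have v: "v (Suc k) \<in> carrier_vec n" "vec_norm2 (v (Suc k)) = 1" "\<eta> (Suc k) \<in> carrier_vec n" if "k < j + 1" for k
    using steps that by (auto simp: eed_steps_def)
  have IH: "strict_upper_norm g i \<le> 5/2 * \<epsilon>"
    using Suc by (simp add: g_def[abs_def] \<epsilon>_def)
  have Si: "S $$ (k, l) = v (Suc k) \<bullet> \<eta> (Suc l)" if "k < Suc i" "l < Suc i" for k l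
    using that v Suc.prems by (simp add: S_def V_def E_def V_mat_gram_index del: index_mult_mat(1))
  have Sc: "S \<in> carrier_mat (Suc i) (Suc i)"
    by (rule carrier_matI) (simp_all add: S_def V_def E_def)
  have entry: "\<bar>g k l\<bar> \<le> \<tau> * (\<Sum>p\<in>{k<..<l}. \<bar>g k p\<bar> * \<bar>g p l\<bar>)
      + 1 / \<gamma> * (\<bar>S $$ (l, k)\<bar> + \<bar>S $$ (k, l)\<bar>)"
    if "k < l" "l < Suc i" for k l
  proof -
    have kl: "k < j" "l < j + 1" using that Suc.prems by auto
    have "\<gamma> * \<bar>g k l\<bar> \<le> \<bar>lam (Suc l) - (lam (Suc k) + \<sigma> (Suc k))\<bar> * \<bar>g k l\<bar>"
      using \<gamma>(2)[OF kl] by (rule mult_right_mono) simp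
    also have "\<dots> = \<bar>(\<Sum>p\<in>{k<..<l}. \<sigma> (Suc p) * (g k p * g p l)) + (S $$ (l, k) - S $$ (k, l))\<bar>"
      using eed_offdiag_eq[OF A steps that(1) kl(2)] that
      by (simp add: Si g_def abs_mult[symmetric])
    also have "\<dots> \<le> (\<Sum>p\<in>{k<..<l}. \<bar>\<sigma> (Suc p)\<bar> * (\<bar>g k p\<bar> * \<bar>g p l\<bar>)) + (\<bar>S $$ (l, k)\<bar> + \<bar>S $$ (k, l)\<bar>)"
      using sum_abs[of "\<lambda>p. \<sigma> (Suc p) * (g k p * g p l)" "{k<..<l}"] by (simp add: abs_mult)
    also have "(\<Sum>p\<in>{k<..<l}. \<bar>\<sigma> (Suc p)\<bar> * (\<bar>g k p\<bar> * \<bar>g p l\<bar>))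
        \<le> (\<Sum>p\<in>{k<..<l}. \<tau> * \<gamma> * (\<bar>g k p\<bar> * \<bar>g p l\<bar>))"
      using kl by (intro sum_mono mult_right_mono \<sigma>) auto
    also have "\<dots> = \<tau> * \<gamma> * (\<Sum>p\<in>{k<..<l}. \<bar>g k p\<bar> * \<bar>g p l\<bar>)"
      by (simp add: sum_distrib_left)
    finally show ?thesis
      using \<gamma>(1) by (simp add: field_simps)
  qed
  have "u \<le> \<tau> * (strict_upper_norm g i * u) + 2 * (1 / \<gamma>) * fro_norm S"
    unfolding u_def
    by (rule strict_upper_norm_Suc_le[OF Sc _ _ entry]) (use \<tau> \<gamma>(1) in auto)
  \<comment> \<open>The induction hypothesis and the smallness assumption bound the coefficient of
    \<open>u\<close> by 5/2 times 1/40.\<close>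
  moreover have "\<tau> * (strict_upper_norm g i * u) \<le> u / 16"
  proof -
    have "\<tau> * (strict_upper_norm g i * u) \<le> \<tau> * (5/2 * \<epsilon> * u)"
      using IH u0 \<tau> by (intro mult_left_mono mult_right_mono) auto
    also have "\<dots> = 5/2 * u * (\<tau> * \<epsilon>)" by simp
    also have "\<dots> \<le> 5/2 * u * (1/40)"
      using small u0 by (intro mult_left_mono) (auto simp: \<epsilon>_def)
    finally show ?thesis by simp
  qed
  moreover have "fro_norm S \<le> (1 + 3/4 * u) * (sqrt (j + 1) * t)"
  proof -
    have E: "fro_norm E \<le> sqrt (j + 1) * t"
    proof -
      have "fro_norm E \<le> sqrt (Suc i) * t"
        unfolding E_def using v res Suc.prems by (intro fro_norm_V_mat_le) auto
      also have "\<dots> \<le> sqrt (j + 1) * t"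
        using Suc.prems res(2) by (intro mult_right_mono) auto
      finally show ?thesis .
    qed
    have om: "fro_norm (transpose_mat V * V - 1\<^sub>m (Suc i)) = sqrt 2 * u"
      using orth_loss_strict_upper[of "Suc i" v n] v Suc.prems
      by (simp add: orth_loss_def V_def u_def g_def[abs_def])
    have s2: "sqrt 2 \<le> 3/2" by (rule real_le_lsqrt) (simp_all add: power2_eq_square)
    have "(fro_norm S)\<^sup>2 \<le> (1 + sqrt 2 * u) * (fro_norm E)\<^sup>2"
      using fro_norm_transpose_mult_le[of V E] om by (simp add: S_def V_def E_def)
    also have "\<dots> \<le> (1 + 3/4 * u)\<^sup>2 * (sqrt (j + 1) * t)\<^sup>2"
    proof (intro mult_mono power_mono E)
      have "sqrt 2 * u \<le> 3/2 * u" using s2 u0 by (rule mult_right_mono)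
      moreover have "(1 + 3/4 * u)\<^sup>2 = 1 + 3/2 * u + (3/4 * u)\<^sup>2"
        by (simp add: power2_eq_square algebra_simps)
      \<comment> \<open>Completing the square makes the bound on \<open>fro_norm S\<close> linear in
        \<open>u\<close>, so it can be absorbed.\<close>
      ultimately show "1 + sqrt 2 * u \<le> (1 + 3/4 * u)\<^sup>2"
        using zero_le_power2[of "3/4 * u"] by linarith
    qed (auto simp: fro_norm_nonneg u0)
    also have "\<dots> = ((1 + 3/4 * u) * (sqrt (j + 1) * t))\<^sup>2"
      by (simp add: power_mult_distrib)
    finally show ?thesis
      by (rule power2_le_imp_le) (use u0 res(2) in auto)
  qed
  then have "2 * (1 / \<gamma>) * fro_norm S \<le> 2 * (1 / \<gamma>) * ((1 + 3/4 * u) * (sqrt (j + 1) * t))"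
    using \<gamma>(1) by (intro mult_left_mono) auto
  then have "2 * (1 / \<gamma>) * fro_norm S \<le> 2 * \<epsilon> + 3/2 * (\<epsilon> * u)"
    by (simp add: \<epsilon>_def algebra_simps add_divide_distrib)
  moreover have "\<epsilon> * u \<le> u / 40"
  proof -
    have "\<epsilon> \<le> \<tau> * \<epsilon>" using mult_right_mono[OF \<tau> \<epsilon>0] by simp
    also have "\<dots> \<le> 1/40" using small by (simp only: \<epsilon>_def)
    finally have "\<epsilon> \<le> 1/40" .
    from mult_right_mono[OF this u0] show ?thesis by simp
  qed
  ultimately have "u \<le> 5/2 * \<epsilon>"
    using u0 \<epsilon>0 by linarith
  then show ?case by (simp add: u_def g_def[abs_def] \<epsilon>_def)
qed

section \<open>Gap, shift ratio and the two final bounds\<close>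

lemma spectral_gap_le:
  assumes "k < j" "l < j + 1"
  shows "spectral_gap \<sigma> lam j \<le> \<bar>lam (Suc l) - (lam (Suc k) + \<sigma> (Suc k))\<bar>"
  unfolding spectral_gap_def
proof (rule Min_le)
  have "{\<bar>l - t\<bar> | l t. l \<in> lam ` {1..j+1} \<and> t \<in> (\<lambda>k. lam k + \<sigma> k) ` {1..j}}
      = (\<lambda>(l, t). \<bar>l - t\<bar>) ` (lam ` {1..j+1} \<times> (\<lambda>k. lam k + \<sigma> k) ` {1..j})"
    by auto
  then show "finite {\<bar>l - t\<bar> | l t. l \<in> lam ` {1..j+1} \<and> t \<in> (\<lambda>k. lam k + \<sigma> k) ` {1..j}}"
    by simp
  have "Suc l \<in> {1..j+1}" "Suc k \<in> {1..j}" using assms by auto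
  then show "\<bar>lam (Suc l) - (lam (Suc k) + \<sigma> (Suc k))\<bar>
      \<in> {\<bar>l - t\<bar> | l t. l \<in> lam ` {1..j+1} \<and> t \<in> (\<lambda>k. lam k + \<sigma> k) ` {1..j}}"
    by blast
qed

lemma abs_shift_le:
  assumes "0 < spectral_gap \<sigma> lam j" "k < j"
  shows "\<bar>\<sigma> (Suc k)\<bar> \<le> shift_gap_ratio \<sigma> lam j * spectral_gap \<sigma> lam j"
proof -
  have "\<bar>\<sigma> (Suc k)\<bar> \<le> Max ((\<lambda>i. \<bar>\<sigma> i\<bar>) ` {1..j})"
    using assms by (intro Max_ge) auto
  then show ?thesis using assms by (simp add: shift_gap_ratio_def)
qed

text \<open>Comparing the first eigenvalue with its own shifted value shows that the gap is at most
  the modulus of the first shift.\<close>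

lemma shift_gap_ratio_ge_1:
  assumes "0 < spectral_gap \<sigma> lam j" "1 \<le> j"
  shows "1 \<le> shift_gap_ratio \<sigma> lam j"
proof -
  have "spectral_gap \<sigma> lam j \<le> \<bar>\<sigma> (Suc 0)\<bar>"
    using spectral_gap_le[of 0 j 0 \<sigma> lam] assms by simp
  also have "\<dots> \<le> shift_gap_ratio \<sigma> lam j * spectral_gap \<sigma> lam j"
    using assms by (intro abs_shift_le) auto
  finally show ?thesis using assms by simp
qed

text \<open>Here \<open>t\<close> stands for \<open>tol\<close> times the spectral norm of
  \<open>A\<close>. The first bound is the strict upper estimate times \<open>sqrt 2\<close>, with
  constant 15/4 rounded up to 4; it also places the Gram matrix within 3/4 of the identity, as the
  polar factor requires.\<close>

lemma eed_backward_error_bounds: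
  fixes \<gamma> \<tau> t C :: real
  assumes A: "A \<in> carrier_mat n n" "sym_mat A" and steps: "eed_steps n A j \<sigma> lam v \<eta>"
    and j: "1 \<le> j" and \<gamma>: "\<gamma> = spectral_gap \<sigma> lam j" "0 < \<gamma>"
    and \<tau>: "\<tau> = shift_gap_ratio \<sigma> lam j" "\<tau> \<le> C"
    and res: "\<And>k. k < j + 1 \<Longrightarrow> vec_norm2 (\<eta> (Suc k)) \<le> t" "0 \<le> t"
    and small: "\<tau> * (sqrt (j + 1) * t / \<gamma>) \<le> 1/40"
  shows "orth_loss n v (j + 1) \<le> 4 * sqrt (j + 1) * t / \<gamma>"
    and "sym_backward_error n A lam v (j + 1) \<le> (75 * C + 30) * real (j + 1) ^ 4 * t"
proof -
  define m where "m = j + 1"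
  define s where "s = sqrt (real m)"
  define g where "g k l = v (Suc k) \<bullet> v (Suc l)" for k l
  define V where "V = V_mat n v m"
  define E where "E = V_mat n \<eta> m"
  define L where "L = Lambda_mat lam m"
  define T where "T = mat m m (\<lambda>(k, l). if k < l then \<sigma> (Suc k) * g k l else 0)"
  define Q where "Q = polar_factor V"
  define \<epsilon> where "\<epsilon> = s * t / \<gamma>"
  have v: "v (Suc k) \<in> carrier_vec n" "vec_norm2 (v (Suc k)) = 1" "\<eta> (Suc k) \<in> carrier_vec n" if "k < m" for k
    using steps that by (auto simp: eed_steps_def m_def)
  have \<tau>1: "1 \<le> \<tau>" using shift_gap_ratio_ge_1 \<gamma> \<tau> j by simp
  have s1: "1 \<le> s" by (simp add: s_def m_def)
  have ss: "s * s = m" by (simp add: s_def)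
  have \<epsilon>0: "0 \<le> \<epsilon>" using res(2) \<gamma>(2) by (simp add: \<epsilon>_def s_def)
  have \<tau>\<epsilon>: "\<tau> * \<epsilon> \<le> 1/40" using small by (simp add: \<epsilon>_def s_def m_def)
  have \<epsilon>1: "\<epsilon> \<le> 1/40" using mult_right_mono[OF \<tau>1 \<epsilon>0] \<tau>\<epsilon> by simp
  have \<sigma>: "\<bar>\<sigma> (Suc k)\<bar> \<le> \<tau> * \<gamma>" if "k < j" for k
    using abs_shift_le that \<gamma> \<tau>(1) by simp
  have u: "strict_upper_norm g m \<le> 5/2 * \<epsilon>"
    unfolding g_def[abs_def] \<epsilon>_def s_def m_def
    by (rule eed_strict_upper_norm_le[OF A steps \<gamma>(2) _ \<sigma> \<tau>1 res small])
      (use spectral_gap_le \<gamma>(1) in auto)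
  have om: "orth_loss n v m = sqrt 2 * strict_upper_norm g m"
    unfolding g_def[abs_def] by (rule orth_loss_strict_upper) (use v in auto)
  also have "\<dots> \<le> 3/2 * (5/2 * \<epsilon>)"
    by (intro mult_mono u strict_upper_norm_nonneg real_le_lsqrt) (auto simp: power2_eq_square)
  finally have om_le: "orth_loss n v m \<le> 15/4 * \<epsilon>" by simp
  then show "orth_loss n v (j + 1) \<le> 4 * sqrt (j + 1) * t / \<gamma>"
    using \<epsilon>0 by (simp add: \<epsilon>_def s_def m_def)
  have Vc: "V \<in> carrier_mat n m" and Ec: "E \<in> carrier_mat n m" and Lc: "L \<in> carrier_mat m m"
    and Tc: "T \<in> carrier_mat m m"
    by (auto simp: V_def E_def L_def T_def intro!: carrier_matI)
  have "fro_norm (transpose_mat V * V - 1\<^sub>m m) \<le> 3/4"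
    using om_le \<epsilon>1 by (simp add: orth_loss_def V_def)
  then obtain Y where Q: "Q \<in> carrier_mat n m" "transpose_mat Q * Q = 1\<^sub>m m"
    and Y: "Y \<in> carrier_mat m m" "transpose_mat Y = Y" "fro_norm Y \<le> 1/2" and VQ: "V = Q * (1\<^sub>m m + Y)"
    unfolding Q_def by (rule polar_factor_near_orthonormal[OF Vc])
  have nn: "0 \<le> fro_norm M" for M by (rule fro_norm_nonneg)
  have V_le: "fro_norm V \<le> s"
    unfolding V_def s_def using fro_norm_V_mat_le[of m v n 1] v by simp
  have E_le: "fro_norm E \<le> s * t"
    unfolding E_def s_def using v res by (intro fro_norm_V_mat_le) (auto simp: m_def)
  \<comment> \<open>The shifts contribute \<open>\<tau> * \<gamma>\<close> and the Gram entries a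
    factor \<open>1 / \<gamma>\<close>, so the gap cancels. Hence this bound for the backward error
    uses the ratio bound \<open>C\<close> but no bound on the norm of \<open>A\<close> over the
    gap.\<close>
  have T_le: "fro_norm T \<le> 5/2 * C * s * t"
  proof -
    have "fro_norm T = L2_set (\<lambda>p. \<bar>T $$ p\<bar>) ({..<m} \<times> {..<m})"
      by (simp add: fro_norm_L2 L2_set_def T_def)
    also have "\<dots> \<le> L2_set (\<lambda>(k, l). \<tau> * \<gamma> * (if k < l then \<bar>g k l\<bar> else 0)) ({..<m} \<times> {..<m})"
      by (rule L2_set_mono) (auto simp: T_def abs_mult m_def intro!: mult_right_mono \<sigma>)
    also have "\<dots> = \<tau> * \<gamma> * strict_upper_norm g m"
      unfolding strict_upper_norm_def using \<tau>1 \<gamma>(2)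
      by (subst L2_set_right_distrib) (auto simp: case_prod_unfold)
    also have "\<dots> \<le> \<tau> * \<gamma> * (5/2 * \<epsilon>)"
      using \<tau>1 \<gamma>(2) u by (intro mult_left_mono) auto
    also have "\<dots> = 5/2 * \<tau> * s * t"
      using \<gamma>(2) by (simp add: \<epsilon>_def)
    also have "\<dots> \<le> 5/2 * C * s * t"
      using \<tau>(2) s1 res(2) by (intro mult_right_mono mult_left_mono) auto
    finally show ?thesis .
  qed
  have Q_le: "fro_norm Q \<le> 2 * s"
  proof -
    have "Q = V - Q * Y"
      unfolding VQ using Q(1) Y(1)
      by (intro eq_matI) (simp_all add: mat_ring del: index_mult_mat(1))
    then have "fro_norm Q \<le> fro_norm V + fro_norm (Q * Y)"
      using fro_norm_minus_le[of V "Q * Y"] Vc Q(1) Y(1) by simp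
    also have "\<dots> \<le> s + fro_norm Q * (1/2)"
      using fro_norm_mult_le[of Q Y] mult_left_mono[OF Y(3) nn[of Q]] Q(1) Y(1) V_le by fastforce
    finally show ?thesis by simp
  qed
  have C0: "0 \<le> C" using \<tau>1 \<tau>(2) by simp
  have "A * V + V * T = V * L + E"
    unfolding V_def E_def L_def T_def g_def m_def by (rule eed_matrix_eq[OF A(1) steps])
  note R = polar_residual_le[OF A Lc _ Vc Tc Ec this Q Y VQ]
  have "sym_mat L" by (simp add: L_def sym_Lambda_mat)
  from R[OF this] have "fro_norm (A * Q - Q * L)
      \<le> 2 * (fro_norm Q * (2 * (fro_norm V)\<^sup>2 * fro_norm T + 2 * fro_norm V * fro_norm E)
          + fro_norm V * fro_norm T + fro_norm E)" .
  also have "\<dots> \<le> 2 * (2 * s * (2 * s\<^sup>2 * (5/2 * C * s * t) + 2 * s * (s * t)) + s * (5/2 * C * s * t) + s * t)"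
    using s1 C0 res(2)
    by (intro mult_left_mono add_mono mult_mono power_mono V_le T_le E_le Q_le order_refl
        mult_nonneg_nonneg add_nonneg_nonneg nn zero_le_power) auto
  also have "\<dots> = 20 * C * t * s ^ 4 + 8 * t * s ^ 3 + 5 * C * t * s ^ 2 + 2 * t * s ^ 1"
    by (simp add: algebra_simps power2_eq_square power3_eq_cube power4_eq_xxxx)
  \<comment> \<open>Since \<open>1 \<le> s\<close>, all powers are raised to the fourth, and the
    coefficients collect to \<open>25 * C + 10\<close>.\<close>
  also have "\<dots> \<le> 20 * C * t * s ^ 4 + 8 * t * s ^ 4 + 5 * C * t * s ^ 4 + 2 * t * s ^ 4"
    using C0 res(2) s1 by (intro add_mono mult_left_mono power_increasing) auto
  finally have R_le: "fro_norm (A * Q - Q * L) \<le> (25 * C + 10) * t * s ^ 4"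
    by (simp add: algebra_simps)
  have "sym_backward_error n A lam v m \<le> (2 * s + s ^ 3) * fro_norm (A * Q - Q * L)"
    using Least_sym_backward_error_le[OF A Lc \<open>sym_mat L\<close> Q]
    by (simp add: sym_backward_error_def Let_def Q_def V_def L_def s_def)
  \<comment> \<open>This product produces the constant \<open>75 * C + 30\<close>; the eighth power
    of \<open>s\<close> is the fourth power of the number of columns.\<close>
  also have "\<dots> \<le> (3 * s ^ 4) * ((25 * C + 10) * t * s ^ 4)"
  proof (rule mult_mono[OF _ R_le])
    have "2 * s ^ 1 + s ^ 3 \<le> 2 * s ^ 4 + s ^ 4"
      using s1 by (intro add_mono mult_left_mono power_increasing) auto
    then show "2 * s + s ^ 3 \<le> 3 * s ^ 4" by simp
  qed (use s1 nn in auto)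
  also have "\<dots> = (75 * C + 30) * (s * s) ^ 4 * t"
    by (simp add: algebra_simps power4_eq_xxxx)
  finally show "sym_backward_error n A lam v (j + 1) \<le> (75 * C + 30) * real (j + 1) ^ 4 * t"
    by (simp add: ss m_def)
qed

theorem theorem3p4:
  shows "\<exists>d::nat. \<forall>C::real. C > 0 \<longrightarrow>
    (\<exists>p::real poly. degree p \<le> d \<and>
      (\<forall>(n::nat) (A::real mat) (j::nat) (tol::real)
         (\<sigma>::nat \<Rightarrow> real) (lam::nat \<Rightarrow> real) (v::nat \<Rightarrow> real vec) (\<eta>::nat \<Rightarrow> real vec).
        A \<in> carrier_mat n n \<longrightarrow> sym_mat A \<longrightarrow> j \<ge> 1 \<longrightarrow> tol > 0 \<longrightarrow>
        eed_steps n A j \<sigma> lam v \<eta> \<longrightarrow>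
        spectral_gap \<sigma> lam j > 0 \<longrightarrow>
        (\<forall>i\<in>{1..j+1}. vec_norm2 (\<eta> i) \<le> tol * spec_norm A) \<longrightarrow>
        shift_gap_ratio \<sigma> lam j * (spec_norm A / spectral_gap \<sigma> lam j) * (4 * sqrt (real (j + 1))) * tol < 0.1 \<longrightarrow>
        inverse (spectral_gap \<sigma> lam j) * spec_norm A \<le> C \<longrightarrow>
        shift_gap_ratio \<sigma> lam j \<le> C \<longrightarrow>
        orth_loss n v (j + 1) \<le> poly p (real j) * tol \<and>
        sym_backward_error n A lam v (j + 1) \<le> poly p (real j) * tol * spec_norm A))"
proof (intro exI[of _ "4::nat"] allI impI)
  fix C :: real assume C: "0 < C"
  \<comment> \<open>The backward error dictates this choice. Only the leading factor depends on
    \<open>C\<close>, so degree 4 serves for every \<open>C\<close>.\<close>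
  define p where "p = smult (75 * C + 30) ([:1, 1:] ^ 4)"
  have p: "poly p (real j) = (75 * C + 30) * real (j + 1) ^ 4" for j
    by (simp add: p_def add.commute)
  have "degree p \<le> 4"
    using degree_power_le[of "[:1, 1 :: real:]" 4] by (simp add: p_def)
  moreover have "orth_loss n v (j + 1) \<le> poly p (real j) * tol \<and>
      sym_backward_error n A lam v (j + 1) \<le> poly p (real j) * tol * spec_norm A"
    if A: "A \<in> carrier_mat n n" "sym_mat A" and j: "j \<ge> 1" and tol: "tol > 0"
      and steps: "eed_steps n A j \<sigma> lam v \<eta>" and gap: "spectral_gap \<sigma> lam j > 0"
      and res: "\<forall>i\<in>{1..j+1}. vec_norm2 (\<eta> i) \<le> tol * spec_norm A"
      and small: "shift_gap_ratio \<sigma> lam j * (spec_norm A / spectral_gap \<sigma> lam j) * (4 * sqrt (real (j + 1))) * tol < 0.1"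
      and C1: "inverse (spectral_gap \<sigma> lam j) * spec_norm A \<le> C" and C2: "shift_gap_ratio \<sigma> lam j \<le> C"
    for n j :: nat and A tol \<sigma> lam v \<eta>
  proof -
    let ?\<gamma> = "spectral_gap \<sigma> lam j" and ?t = "tol * spec_norm A"
    have res': "vec_norm2 (\<eta> (Suc k)) \<le> ?t" if "k < j + 1" for k
      using res that by auto
    \<comment> \<open>Nonnegativity of \<open>?t\<close> is read off from the first residual bound,
      which avoids any argument about the supremum in \<open>spec_norm\<close>.\<close>
    have "0 \<le> vec_norm2 (\<eta> (Suc 0))"
      by (simp add: vec_norm2_def scalar_prod_self_nonneg)
    then have t0: "0 \<le> ?t" using res'[of 0] by simp
    \<comment> \<open>Dividing the assumption by its factor 4 turns 0.1 into 1/40.\<close>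
    have small': "shift_gap_ratio \<sigma> lam j * (sqrt (j + 1) * ?t / ?\<gamma>) \<le> 1/40"
      using small by (simp add: algebra_simps)
    note bounds = eed_backward_error_bounds[OF A steps j refl gap refl C2 res' t0 small']
    have "orth_loss n v (j + 1) \<le> 4 * sqrt (j + 1) * tol * (inverse ?\<gamma> * spec_norm A)"
      using bounds(1) by (simp add: field_simps)
    also have "\<dots> \<le> 4 * real (j + 1) ^ 4 * tol * C"
    proof -
      \<comment> \<open>The square root is enlarged to the fourth power of \<open>j + 1\<close>, so
        that the polynomial chosen for the backward error covers the loss of orthogonality
        too.\<close>
      have "sqrt (j + 1) \<le> (sqrt (j + 1)) ^ 8"
        by (rule self_le_power) auto
      also have "\<dots> = ((sqrt (j + 1))\<^sup>2) ^ 4"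
        by (simp only: power_mult[symmetric]) simp
      finally have "sqrt (j + 1) \<le> real (j + 1) ^ 4" by simp
      then have "4 * sqrt (j + 1) * tol \<le> 4 * real (j + 1) ^ 4 * tol"
        using tol by (intro mult_right_mono mult_left_mono) auto
      moreover have "4 * sqrt (j + 1) * tol * (inverse ?\<gamma> * spec_norm A) \<le> 4 * sqrt (j + 1) * tol * C"
        using C1 tol by (intro mult_left_mono) auto
      ultimately show ?thesis
        using C by (meson mult_right_mono order_trans less_imp_le)
    qed
    also have "\<dots> = (4 * C) * real (j + 1) ^ 4 * tol" by simp
    also have "\<dots> \<le> poly p (real j) * tol"
      unfolding p using C tol by (intro mult_right_mono) auto
    finally show ?thesis
      using bounds(2) by (simp add: p mult.assoc)
  qed
  ultimately show "\<exists>p::real poly. degree p \<le> 4 \<and>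
      (\<forall>(n::nat) (A::real mat) (j::nat) (tol::real)
         (\<sigma>::nat \<Rightarrow> real) (lam::nat \<Rightarrow> real) (v::nat \<Rightarrow> real vec) (\<eta>::nat \<Rightarrow> real vec).
        A \<in> carrier_mat n n \<longrightarrow> sym_mat A \<longrightarrow> j \<ge> 1 \<longrightarrow> tol > 0 \<longrightarrow>
        eed_steps n A j \<sigma> lam v \<eta> \<longrightarrow>
        spectral_gap \<sigma> lam j > 0 \<longrightarrow>
        (\<forall>i\<in>{1..j+1}. vec_norm2 (\<eta> i) \<le> tol * spec_norm A) \<longrightarrow>
        shift_gap_ratio \<sigma> lam j * (spec_norm A / spectral_gap \<sigma> lam j) * (4 * sqrt (real (j + 1))) * tol < 0.1 \<longrightarrow>
        inverse (spectral_gap \<sigma> lam j) * spec_norm A \<le> C \<longrightarrow>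
        shift_gap_ratio \<sigma> lam j \<le> C \<longrightarrow>
        orth_loss n v (j + 1) \<le> poly p (real j) * tol \<and>
        sym_backward_error n A lam v (j + 1) \<le> poly p (real j) * tol * spec_norm A)"
    by blast
qed

end
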